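(* Let $\mathfrak{A}$ be a unital C*-algebra and let $\mathsf{L}_1$, $\mathsf{L}_2$ be two lower semi-continuous Lip-norms on $\mathfrak{A}$. The following assertions are equivalent: (1) $\mathsf{L}_1$ and $\mathsf{L}_2$ are equivalent; (2) $\mathrm{dom}(\mathsf{L}_1)=\mathrm{dom}(\mathsf{L}_2)$.
   Context: For a unital C*-algebra $\mathfrak{A}$ with unit $1_{\mathfrak{A}}$, $\mathfrak{sa}(\mathfrak{A})$ is the space of self-adjoint elements and $\mathscr{S}(\mathfrak{A})$ the state space. A Lip-norm on $\mathfrak{A}$ is a seminorm $\mathsf{L}$ defined on a dense subspace $\mathrm{dom}(\mathsf{L})$ of $\mathfrak{sa}(\mathfrak{A})$ such that $\{a\in\mathrm{dom}(\mathsf{L}):\mathsf{L}(a)=0\}=\mathbb{R}1_{\mathfrak{A}}$ and the Monge-Kantorovich metric $\mathsf{mk}_{\mathsf{L}}(\varphi,\psi)=\sup\{|\varphi(a)-\psi(a)| : a\in\mathrm{dom}(\mathsf{L}),\ \mathsf{L}(a)\leq 1\}$ metrizes the weak* topology on $\mathscr{S}(\mathfrak{A})$. A Lip-norm takes the value $\infty$ outside its domain. $\mathsf{L}$ is lower semi-continuous when $\{a\in\mathrm{dom}(\mathsf{L}):\mathsf{L}(a)\leq 1\}$ is norm closed in $\mathfrak{sa}(\mathfrak{A})$. Two Lip-norms $\mathsf{L}_1,\mathsf{L}_2$ are equivalent when there exists $C>0$ such that $C^{-1}\mathsf{L}_1\leq\mathsf{L}_2\leq C\,\mathsf{L}_1$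 as $[0,\infty]$-valued functions on $\mathfrak{sa}(\mathfrak{A})$. *)

theory Defs
  imports "HOL-Analysis.Analysis"
begin

text \<open>
  The base classes supply a real Banach algebra with \<open>norm 1 = 1\<close>, so that \<open>1 \<noteq> 0\<close>; the complex
  scalar multiplication is required to extend the real one.
\<close>

class unital_cstar_algebra = real_normed_algebra_1 + banach +
  fixes scaleC :: "complex \<Rightarrow> 'a \<Rightarrow> 'a" (infixr "*\<^sub>C" 75)
    and star :: "'a \<Rightarrow> 'a"
  assumes scaleC_of_real: "complex_of_real r *\<^sub>C a = r *\<^sub>R a"
    and scaleC_add_right: "c *\<^sub>C (a + b) = c *\<^sub>C a + c *\<^sub>C b"
    and scaleC_add_left: "(c + d) *\<^sub>C a = c *\<^sub>C a + d *\<^sub>C a"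
    and scaleC_scaleC: "c *\<^sub>C d *\<^sub>C a = (c * d) *\<^sub>C a"
    and mult_scaleC_left: "(c *\<^sub>C a) * b = c *\<^sub>C (a * b)"
    and mult_scaleC_right: "a * (c *\<^sub>C b) = c *\<^sub>C (a * b)"
    and norm_scaleC: "norm (c *\<^sub>C a) = cmod c * norm a"
    and star_add: "star (a + b) = star a + star b"
    and star_scaleC: "star (c *\<^sub>C a) = cnj c *\<^sub>C star a"
    and star_mult: "star (a * b) = star b * star a"
    and star_star: "star (star a) = a"
    and cstar_identity: "norm (star a * a) = (norm a)\<^sup>2"

lemma vector_space_scaleC: "vector_space (scaleC :: complex \<Rightarrow> 'a::unital_cstar_algebra \<Rightarrow> 'a)"
proof
  show "1 *\<^sub>C a = a" for a :: 'a
    using scaleC_of_real[of 1 a] by simp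
qed (simp_all add: scaleC_add_right scaleC_add_left scaleC_scaleC)

instantiation complex :: unital_cstar_algebra
begin

definition scaleC_complex :: "complex \<Rightarrow> complex \<Rightarrow> complex"
  where "scaleC_complex = (*)"

definition star_complex :: "complex \<Rightarrow> complex"
  where "star_complex = cnj"

instance
  by standard (auto simp: scaleC_complex_def star_complex_def algebra_simps norm_mult
      scaleR_conv_of_real power2_eq_square)

end

definition self_adjoints :: "'a::unital_cstar_algebra set"
  where "self_adjoints = {a. star a = a}"

definition state_space :: "('a::unital_cstar_algebra \<Rightarrow> complex) set"
  where "state_space =
    {\<phi>. Vector_Spaces.linear scaleC (*) \<phi> \<and> (\<forall>a. \<phi> (star a * a) \<in> \<real>\<^sub>\<ge>\<^sub>0) \<and> \<phi> 1 = 1}"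

text \<open>The weak* topology is that of pointwise convergence, inherited from the product of copies of
  the complex plane indexed by the algebra.\<close>

definition weak_star_topology :: "('a::unital_cstar_algebra \<Rightarrow> complex) topology"
  where "weak_star_topology = subtopology (product_topology (\<lambda>_. euclidean) UNIV) state_space"

text \<open>
  A seminorm on a subspace of the self-adjoint elements is a \<open>[0, \<infinity>]\<close>-valued function which is
  infinite outside that subspace. It is only ever evaluated at self-adjoint elements; its values
  elsewhere are irrelevant.
\<close>

definition lip_dom :: "('a::unital_cstar_algebra \<Rightarrow> ennreal) \<Rightarrow> 'a set"
  where "lip_dom L = {a \<in> self_adjoints. L a < \<infinity>}"

definition lip_ball :: "('a::unital_cstar_algebra \<Rightarrow> ennreal) \<Rightarrow> 'a set"
  where "lip_ball L = {a \<in> lip_dom L. L a \<le> 1}"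

definition mk_dist ::
    "('a::unital_cstar_algebra \<Rightarrow> ennreal) \<Rightarrow> ('a \<Rightarrow> complex) \<Rightarrow> ('a \<Rightarrow> complex) \<Rightarrow> ennreal"
  where "mk_dist L \<phi> \<psi> = (SUP a\<in>lip_ball L. ennreal (cmod (\<phi> a - \<psi> a)))"

text \<open>The supremum may a priori be infinite; being a metric includes being finite. The finiteness
  clause is needed because \<^const>\<open>enn2real\<close> maps \<open>\<infinity>\<close> to \<open>0\<close>.\<close>

definition mk_metrizes_weak_star :: "('a::unital_cstar_algebra \<Rightarrow> ennreal) \<Rightarrow> bool"
  where "mk_metrizes_weak_star L \<longleftrightarrow>
    (\<forall>\<phi>\<in>state_space. \<forall>\<psi>\<in>state_space. mk_dist L \<phi> \<psi> < \<infinity>) \<and>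
    Metric_space state_space (\<lambda>\<phi> \<psi>. enn2real (mk_dist L \<phi> \<psi>)) \<and>
    Metric_space.mtopology state_space (\<lambda>\<phi> \<psi>. enn2real (mk_dist L \<phi> \<psi>)) = weak_star_topology"

definition lip_norm :: "('a::unital_cstar_algebra \<Rightarrow> ennreal) \<Rightarrow> bool"
  where "lip_norm L \<longleftrightarrow>
    subspace (lip_dom L) \<and>
    self_adjoints \<subseteq> closure (lip_dom L) \<and>
    (\<forall>a\<in>lip_dom L. \<forall>b\<in>lip_dom L. L (a + b) \<le> L a + L b) \<and>
    (\<forall>r. \<forall>a\<in>lip_dom L. L (r *\<^sub>R a) = ennreal \<bar>r\<bar> * L a) \<and>
    {a \<in> lip_dom L. L a = 0} = range (\<lambda>r. r *\<^sub>R 1) \<and>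
    mk_metrizes_weak_star L"

definition lip_lsc :: "('a::unital_cstar_algebra \<Rightarrow> ennreal) \<Rightarrow> bool"
  where "lip_lsc L \<longleftrightarrow> closedin (top_of_set self_adjoints) (lip_ball L)"

definition lip_equivalent ::
    "('a::unital_cstar_algebra \<Rightarrow> ennreal) \<Rightarrow> ('a \<Rightarrow> ennreal) \<Rightarrow> bool"
  where "lip_equivalent L\<^sub>1 L\<^sub>2 \<longleftrightarrow>
    (\<exists>C::real. C > 0 \<and>
      (\<forall>a\<in>self_adjoints. ennreal (inverse C) * L\<^sub>1 a \<le> L\<^sub>2 a \<and> L\<^sub>2 a \<le> ennreal C * L\<^sub>1 a))"

end

theory Submission
  imports Defs
begin

text \<open>
  Modulo the scalars, the unit ball of \<open>L\<^sub>1\<close> is norm bounded: the state space is weak* compact, so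
  it has finite diameter for the Monge-Kantorovich metric, and the states determine the norm of
  self-adjoint elements. A suitably large bounded piece \<open>U\<close> of the \<open>L\<^sub>1\<close>-ball is therefore closed,
  convex and, if the domains agree, covered by the multiples of the closed \<open>L\<^sub>2\<close>-ball. By Baire's
  theorem a single multiple absorbs \<open>U\<close>, which bounds \<open>L\<^sub>2\<close> by a multiple of \<open>L\<^sub>1\<close>.

  That the states are norming rests on the positivity of \<open>b\<^sup>* b\<close>. It is obtained without spectral
  theory: a self-adjoint \<open>g\<close> is called positive if \<open>\<parallel>t - g\<parallel> \<le> t\<close> for some \<open>t\<close>, and such elements
  have positive square roots.
\<close>

section \<open>Involution and square roots\<close>

interpretation complex_scaling: vector_space "scaleC :: complex \<Rightarrow> 'a::unital_cstar_algebra \<Rightarrow> 'a"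
  by (rule vector_space_scaleC)

lemma star_scaleR: "star (r *\<^sub>R a) = r *\<^sub>R star (a :: 'a::unital_cstar_algebra)"
  by (metis complex_cnj_complex_of_real scaleC_of_real star_scaleC)

lemma star_zero [simp]: "star (0 :: 'a::unital_cstar_algebra) = 0"
  using star_scaleR[of 0 "0::'a"] by simp

lemma star_minus: "star (- a) = - star (a :: 'a::unital_cstar_algebra)"
  using star_scaleR[of "-1" a] by simp

lemma star_diff: "star (a - b) = star a - star (b :: 'a::unital_cstar_algebra)"
  using star_add[of a "-b"] by (simp add: star_minus)

lemma star_one [simp]: "star (1 :: 'a::unital_cstar_algebra) = 1"
  by (metis mult.left_neutral mult.right_neutral star_mult star_star)

lemma star_of_real [simp]: "star (of_real r :: 'a::unital_cstar_algebra) = of_real r"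
  by (simp add: of_real_def star_scaleR)

lemma norm_star [simp]: "norm (star a) = norm (a :: 'a::unital_cstar_algebra)"
proof -
  have le: "norm b \<le> norm (star b)" for b :: 'a
  proof (cases "b = 0")
    case False
    have "norm b * norm b \<le> norm (star b) * norm b"
      using cstar_identity[of b] norm_mult_ineq[of "star b" b] by (simp add: power2_eq_square)
    with False show ?thesis by simp
  qed simp
  show ?thesis
    using le[of a] le[of "star a"] by (simp add: star_star)
qed

lemma bounded_linear_star: "bounded_linear (star :: 'a::unital_cstar_algebra \<Rightarrow> 'a)"
  by (rule bounded_linear_intro[of _ 1]) (simp_all add: star_add star_scaleR)

lemmas tendsto_star = bounded_linear.tendsto[OF bounded_linear_star]

lemma closed_self_adjoints: "closed (self_adjoints :: 'a::unital_cstar_algebra set)"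
  unfolding self_adjoints_def
  by (intro closed_Collect_eq linear_continuous_on bounded_linear_star continuous_on_id)

lemma self_adjoints_iff: "a \<in> self_adjoints \<longleftrightarrow> star a = a"
  by (simp add: self_adjoints_def)

lemma norm_self_adjoint_square:
  "norm (a * a) = (norm a)\<^sup>2" if "star a = a" for a :: "'a::unital_cstar_algebra"
  using cstar_identity[of a] that by simp

lemma star_mult_eq_0:
  "star a * a = 0 \<longleftrightarrow> a = 0" for a :: "'a::unital_cstar_algebra"
  using cstar_identity[of a] by auto

text \<open>The limit \<open>y\<close> of the iteration satisfies \<open>2 y = h + y\<^sup>2\<close>, so that \<open>1 - y\<close> is a square root
  of \<open>1 - h\<close>.\<close>

primrec sqrt_iter :: "'a::real_algebra_1 \<Rightarrow> nat \<Rightarrow> 'a" where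
  "sqrt_iter h 0 = 0"
| "sqrt_iter h (Suc n) = (1/2) *\<^sub>R (h + sqrt_iter h n * sqrt_iter h n)"

text \<open>Each iterate is a polynomial in \<open>h\<close>. Hence the iterates commute with each
  other and, in the limit, the square root commutes with whatever commutes with
  \<open>h\<close>.\<close>

lemma sqrt_iter_commute:
  assumes "b * h = h * b"
  shows "b * sqrt_iter h n = sqrt_iter h n * b"
proof (induction n)
  case (Suc n)
  have "b * (sqrt_iter h n * sqrt_iter h n) = (sqrt_iter h n * sqrt_iter h n) * b"
    by (metis Suc mult.assoc)
  with assms show ?case by (simp add: algebra_simps)
qed simp

lemma sqrt_iter_one_bounds: "0 \<le> sqrt_iter (1::real) n \<and> sqrt_iter (1::real) n \<le> 1"
proof (induction n)
  case (Suc n)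
  then show ?case by (auto simp: mult_le_one)
qed simp

text \<open>The recursion has nonnegative coefficients, so the scalar iteration at 1 is a
  majorant.\<close>

lemma norm_sqrt_iter_le:
  fixes h :: "'a::real_normed_algebra_1"
  assumes "norm h \<le> 1"
  shows "norm (sqrt_iter h n) \<le> sqrt_iter 1 n"
proof (induction n)
  case (Suc n)
  have "norm (h + sqrt_iter h n * sqrt_iter h n) \<le> 1 + sqrt_iter 1 n * sqrt_iter 1 n"
    by (rule norm_triangle_mono[OF assms])
      (meson Suc mult_mono norm_ge_zero norm_mult_ineq order_trans sqrt_iter_one_bounds)
  then show ?case by simp
qed simp

text \<open>The majorant also controls the increments. This covers the boundary case
  \<open>norm h = 1\<close>, where the recursion need not be a strict contraction.\<close>

lemma norm_sqrt_iter_diff_le: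
  fixes h :: "'a::real_normed_algebra_1"
  assumes "norm h \<le> 1"
  shows "norm (sqrt_iter h (Suc n) - sqrt_iter h n) \<le> sqrt_iter 1 (Suc n) - sqrt_iter 1 n"
proof (induction n)
  case 0
  then show ?case using assms by simp
next
  case (Suc n)
  let ?y = "sqrt_iter h" and ?e = "sqrt_iter (1::real)"
  \<comment> \<open>\<open>?y (Suc n)\<close> commutes with \<open>h\<close>, hence with
    \<open>?y n\<close>, so the difference of squares factors.\<close>
  have "h * ?y (Suc n) = ?y (Suc n) * h" by (rule sqrt_iter_commute) simp
  then have "?y (Suc n) * ?y n = ?y n * ?y (Suc n)" by (rule sqrt_iter_commute[OF sym])
  then have y: "?y (Suc (Suc n)) - ?y (Suc n) = (1/2) *\<^sub>R ((?y (Suc n) + ?y n) * (?y (Suc n) - ?y n))"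
    unfolding sqrt_iter.simps(2)[of h "Suc n"] by (subst (3) sqrt_iter.simps(2))
      (simp add: algebra_simps del: sqrt_iter.simps)
  have e: "?e (Suc (Suc n)) - ?e (Suc n) = (1/2) * ((?e (Suc n) + ?e n) * (?e (Suc n) - ?e n))"
    unfolding sqrt_iter.simps(2)[of "1::real" "Suc n"] by (subst (3) sqrt_iter.simps(2))
      (simp add: algebra_simps del: sqrt_iter.simps)
  have "norm (?y (Suc n) + ?y n) \<le> ?e (Suc n) + ?e n"
    by (intro norm_triangle_mono norm_sqrt_iter_le assms)
  then have "norm (?y (Suc n) + ?y n) * norm (?y (Suc n) - ?y n)
      \<le> (?e (Suc n) + ?e n) * (?e (Suc n) - ?e n)"
    using Suc sqrt_iter_one_bounds[of "Suc n"] sqrt_iter_one_bounds[of n]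
    by (intro mult_mono) (auto simp del: sqrt_iter.simps)
  then have "norm ((?y (Suc n) + ?y n) * (?y (Suc n) - ?y n))
      \<le> (?e (Suc n) + ?e n) * (?e (Suc n) - ?e n)"
    using norm_mult_ineq order_trans by blast
  then show ?case
    unfolding y e by simp
qed

text \<open>The scalar iterates increase and are bounded, so their increments are summable. By
  comparison so are those of \<open>sqrt_iter h\<close>, whose partial sums are the iterates because
  the iteration starts at 0.\<close>

lemma convergent_sqrt_iter:
  fixes h :: "'a::{real_normed_algebra_1,banach}"
  assumes "norm h \<le> 1"
  shows "convergent (sqrt_iter h)"
proof -
  let ?e = "sqrt_iter (1::real)"
  \<comment> \<open>For \<open>h = 1\<close> in the reals, the scalar increment bounds a norm and is
    therefore nonnegative.\<close>
  have "incseq ?e"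
    using norm_sqrt_iter_diff_le[of "1::real"]
    by (intro incseq_SucI) (smt (verit) norm_ge_zero norm_one)
  then obtain l where "?e \<longlonglongrightarrow> l"
    using incseq_convergent sqrt_iter_one_bounds by metis
  then have "summable (\<lambda>n. ?e (Suc n) - ?e n)"
    using telescope_summable by blast
  then have "summable (\<lambda>n. sqrt_iter h (Suc n) - sqrt_iter h n)"
    by (rule summable_comparison_test[rotated]) (use norm_sqrt_iter_diff_le[OF assms] in blast)
  then have "convergent (\<lambda>n. \<Sum>k<n. sqrt_iter h (Suc k) - sqrt_iter h k)"
    by (simp add: summable_iff_convergent)
  then show ?thesis
    by (simp add: sum_lessThan_telescope del: sqrt_iter.simps(2))
qed

text \<open>All four properties pass from the iterates to the limit. The commutation clause stands
  in for functional calculus: it makes roots of commuting elements commute.\<close>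

lemma square_root_near_one:
  fixes g :: "'a::unital_cstar_algebra"
  assumes "star g = g" and "norm (1 - g) \<le> 1"
  obtains c where "star c = c" and "c * c = g" and "norm (1 - c) \<le> 1"
    and "\<And>b. b * g = g * b \<Longrightarrow> b * c = c * b"
proof -
  let ?y = "sqrt_iter (1 - g)"
  obtain y where y: "?y \<longlonglongrightarrow> y"
    using convergent_sqrt_iter[OF assms(2)] convergent_def by blast
  have "(\<lambda>n. ?y (Suc n)) \<longlonglongrightarrow> (1/2) *\<^sub>R (1 - g + y * y)"
    unfolding sqrt_iter.simps by (intro tendsto_intros y)
  then have "y = (1/2) *\<^sub>R (1 - g + y * y)"
    using y LIMSEQ_Suc LIMSEQ_unique by blast
  then have "2 *\<^sub>R y = 1 - g + y * y"
    by (metis divide_self_if mult.commute scaleR_one scaleR_scaleR times_divide_eq_left zero_neq_numeral mult_1)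
  then have "(1 - y) * (1 - y) = g"
    by (simp add: algebra_simps scaleR_2)
  have "star (?y n) = ?y n" for n
    by (induction n) (simp_all add: star_scaleR star_add star_diff star_mult assms)
  then have "star y = y"
    using tendsto_star[OF y] y LIMSEQ_unique by auto
  have "norm (?y n) \<le> 1" for n
    using norm_sqrt_iter_le[OF assms(2)] sqrt_iter_one_bounds order_trans by blast
  then have "norm y \<le> 1"
    using tendsto_norm[OF y] by (intro LIMSEQ_le_const2) auto
  have commute: "b * y = y * b" if "b * g = g * b" for b
  proof -
    have "b * ?y n = ?y n * b" for n
      by (rule sqrt_iter_commute) (simp add: algebra_simps that)
    then show ?thesis
      using tendsto_mult_left[OF y, of b] tendsto_mult_right[OF y, of b] LIMSEQ_unique by auto
  qed
  show thesis
  proof (rule that)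
    show "star (1 - y) = 1 - y" using \<open>star y = y\<close> by (simp add: star_diff)
    show "(1 - y) * (1 - y) = g" by fact
    show "norm (1 - (1 - y)) \<le> 1" using \<open>norm y \<le> 1\<close> by simp
    show "b * (1 - y) = (1 - y) * b" if "b * g = g * b" for b
      using commute[OF that] by (simp add: left_diff_distrib right_diff_distrib)
  qed
qed

section \<open>Positive elements\<close>

text \<open>In spectral terms, \<open>g\<close> has spectrum in [0, 2 t]. In this form sums are
  handled by the triangle inequality alone.\<close>

definition positives :: "'a::unital_cstar_algebra set"
  where "positives = {g. star g = g \<and> (\<exists>t. norm (of_real t - g) \<le> t)}"

lemma star_positive: "g \<in> positives \<Longrightarrow> star g = g"
  by (simp add: positives_def)

lemma positives_add:
  assumes "g \<in> positives" and "k \<in> positives"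
  shows "g + k \<in> positives"
proof -
  obtain s t where "norm (of_real s - g) \<le> s" "norm (of_real t - k) \<le> t"
    using assms by (auto simp: positives_def)
  then have "norm (of_real (s + t) - (g + k)) \<le> s + t"
    using norm_triangle_mono[of "of_real s - g" s "of_real t - k" t] by (simp add: algebra_simps)
  with assms show ?thesis unfolding positives_def by (auto simp only: mem_Collect_eq star_add)
qed

lemma positives_scaleR:
  assumes "g \<in> positives" and "r \<ge> 0"
  shows "r *\<^sub>R g \<in> positives"
proof -
  obtain t where "norm (of_real t - g) \<le> t"
    using assms by (auto simp: positives_def)
  moreover have "of_real (r * t) - r *\<^sub>R g = r *\<^sub>R (of_real t - g)"
    by (simp add: algebra_simps of_real_def)
  ultimately have "norm (of_real (r * t) - r *\<^sub>R g) \<le> r * t"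
    using assms(2) by (simp add: mult_left_mono)
  with assms show ?thesis unfolding positives_def by (auto simp only: mem_Collect_eq star_scaleR)
qed

lemma of_real_positive_iff: "of_real r \<in> positives \<longleftrightarrow> r \<ge> 0"
proof
  assume "of_real r \<in> (positives :: 'a set)"
  then obtain t where "norm (of_real t - of_real r :: 'a) \<le> t"
    by (auto simp: positives_def)
  then have "\<bar>t - r\<bar> \<le> t"
    by (metis norm_of_real of_real_diff)
  then show "r \<ge> 0" by linarith
next
  assume "r \<ge> 0"
  then show "of_real r \<in> (positives :: 'a set)"
    by (auto simp: positives_def intro!: exI[of _ r])
qed

lemma zero_positive [simp]: "0 \<in> positives"
  using of_real_positive_iff[of 0] by simp

lemma positives_of_norm_le:
  assumes "star a = a" and "norm a \<le> t"
  shows "of_real t - a \<in> positives" and "of_real t + a \<in> positives"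
  using assms by (auto simp: positives_def star_diff star_add intro!: exI[of _ t])

text \<open>Division by \<open>t\<close> moves \<open>g\<close> within distance 1 of the unit. The
  root of the quotient is again that close to the unit, hence positive, and is scaled back by
  \<open>sqrt t\<close>.\<close>

lemma positive_square_root:
  fixes g :: "'a::unital_cstar_algebra"
  assumes "g \<in> positives"
  obtains c where "c \<in> positives" and "c * c = g" and "\<And>b. b * g = g * b \<Longrightarrow> b * c = c * b"
proof -
  obtain t where t: "norm (of_real t - g) \<le> t"
    using assms by (auto simp: positives_def)
  show thesis
  proof (cases "t = 0")
    case True
    with t have "g = 0" by simp
    then show thesis
      by (intro that[of 0]) auto
  next
    case False
    with t have "t > 0" by (metis norm_ge_zero order_le_less order_trans)
    let ?g = "(1/t) *\<^sub>R g"
    have "1 - ?g = (1/t) *\<^sub>R (of_real t - g)"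
      using \<open>t > 0\<close> by (simp add: algebra_simps of_real_def)
    then have "norm (1 - ?g) \<le> 1"
      using t \<open>t > 0\<close> by simp
    moreover have "star ?g = ?g"
      using assms by (simp add: star_scaleR star_positive)
    ultimately obtain c where c: "star c = c" "c * c = ?g" "norm (1 - c) \<le> 1"
      "\<And>b. b * ?g = ?g * b \<Longrightarrow> b * c = c * b"
      using square_root_near_one by blast
    show thesis
    proof (rule that)
      have "c \<in> positives"
        using c(1,3) by (auto simp: positives_def intro!: exI[of _ 1])
      then show "sqrt t *\<^sub>R c \<in> positives"
        using \<open>t > 0\<close> by (intro positives_scaleR) auto
      show "sqrt t *\<^sub>R c * sqrt t *\<^sub>R c = g"
        using c(2) \<open>t > 0\<close> by simp
      show "b * sqrt t *\<^sub>R c = sqrt t *\<^sub>R c * b" if "b * g = g * b" for b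
        using c(4)[of b] that by simp
    qed
  qed
qed

text \<open>For self-adjoint \<open>u\<close>, \<open>v\<close> and w = u + i v these are
  \<open>w * star w\<close> and \<open>star w * w\<close>. The commutators have opposite signs: they
  cancel in the sum and vanish when \<open>u\<close> and \<open>v\<close> commute.\<close>

lemma cartesian_product:
  fixes u v :: "'a::unital_cstar_algebra"
  shows "(u + \<i> *\<^sub>C v) * (u - \<i> *\<^sub>C v) = u * u + v * v + \<i> *\<^sub>C (v * u - u * v)"
    and "(u - \<i> *\<^sub>C v) * (u + \<i> *\<^sub>C v) = u * u + v * v + \<i> *\<^sub>C (u * v - v * u)"
  by (simp_all add: distrib_left distrib_right left_diff_distrib right_diff_distrib
      mult_scaleC_left mult_scaleC_right scaleC_scaleC scaleC_add_right
      complex_scaling.scale_right_diff_distrib)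

lemma star_cartesian:
  fixes u v :: "'a::unital_cstar_algebra"
  assumes "star u = u" and "star v = v"
  shows "star (u + \<i> *\<^sub>C v) = u - \<i> *\<^sub>C v"
  using assms by (simp add: star_add star_scaleC)

text \<open>\<open>u\<close> is the real part of w = u + i v, so \<open>norm u <= norm w\<close>; by
  the C*-identity the square of \<open>norm w\<close> is the norm of \<open>star w * w\<close>,
  which is the sum of squares.\<close>

lemma norm_le_sum_squares:
  fixes u v :: "'a::unital_cstar_algebra"
  assumes "star u = u" and "star v = v" and "u * v = v * u"
  shows "(norm u)\<^sup>2 \<le> norm (u * u + v * v)"
proof -
  let ?w = "u + \<i> *\<^sub>C v"
  have "u = (1/2) *\<^sub>R (?w + star ?w)"
    unfolding star_cartesian[OF assms(1,2)] by (simp add: scaleR_2[symmetric])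
  then have "norm u = norm ((1/2) *\<^sub>R (?w + star ?w))"
    by (rule arg_cong)
  then have "norm u \<le> norm ?w"
    using norm_triangle_ineq[of ?w "star ?w"] norm_scaleR[of "1/2" "?w + star ?w"] norm_star[of ?w]
    by simp
  then have "(norm u)\<^sup>2 \<le> (norm ?w)\<^sup>2"
    by (simp add: power_mono)
  also have "\<dots> = norm (star ?w * ?w)"
    by (simp only: cstar_identity)
  also have "\<dots> = norm (u * u + v * v)"
    unfolding star_cartesian[OF assms(1,2)] cartesian_product(2) using assms(3) by simp
  finally show ?thesis .
qed

text \<open>If \<open>norm k <= 1\<close>, then \<open>1 - k * k\<close> has a root \<open>c\<close>
  commuting with \<open>k\<close>, and \<open>c * c + k * k = 1\<close> bounds
  \<open>norm (c * c)\<close> by 1. So \<open>t = 1\<close> witnesses the positivity of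
  \<open>k * k\<close>; scaling does the rest.\<close>

lemma square_positive:
  fixes h :: "'a::unital_cstar_algebra"
  assumes "star h = h"
  shows "h * h \<in> positives"
proof -
  have unit: "k * k \<in> positives" if k: "star k = k" "norm k \<le> 1" for k :: 'a
  proof -
    have "norm (1 - (1 - k * k)) \<le> 1"
      using k by (simp add: norm_self_adjoint_square power_le_one)
    moreover have "star (1 - k * k) = 1 - k * k"
      using k by (simp add: star_diff star_mult)
    ultimately obtain c where c: "star c = c" "c * c = 1 - k * k"
      "\<And>b. b * (1 - k * k) = (1 - k * k) * b \<Longrightarrow> b * c = c * b"
      using square_root_near_one by blast
    have "k * c = c * k"
      by (rule c(3)) (simp add: algebra_simps)
    then have "(norm c)\<^sup>2 \<le> norm (c * c + k * k)"
      using c(1) k(1) by (intro norm_le_sum_squares) simp_all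
    then have "norm (1 - k * k) \<le> 1"
      using c(1,2) norm_self_adjoint_square[of c] by simp
    then show ?thesis
      using k by (auto simp: positives_def star_mult intro!: exI[of _ 1])
  qed
  show ?thesis
  proof (cases "h = 0")
    case True
    then show ?thesis using unit[of 0] by simp
  next
    case False
    define k where "k = (1 / norm h) *\<^sub>R h"
    have "k * k \<in> positives"
      using False assms by (intro unit) (auto simp: k_def star_scaleR)
    then have "(norm h)\<^sup>2 *\<^sub>R (k * k) \<in> positives"
      by (intro positives_scaleR) auto
    then show ?thesis
      using False by (simp add: k_def power2_eq_square)
  qed
qed

text \<open>The product is the square of the self-adjoint element \<open>c * d\<close> formed from
  the roots.\<close>

lemma positives_mult:
  assumes "g \<in> positives" and "k \<in> positives" and "g * k = k * g"
  shows "g * k \<in> positives"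
proof -
  obtain c where c: "c \<in> positives" "c * c = g" "\<And>b. b * g = g * b \<Longrightarrow> b * c = c * b"
    using positive_square_root[OF assms(1)] by blast
  obtain d where d: "d \<in> positives" "d * d = k" "\<And>b. b * k = k * b \<Longrightarrow> b * d = d * b"
    using positive_square_root[OF assms(2)] by blast
  \<comment> \<open>Commutation passes from \<open>g\<close>, \<open>k\<close> to \<open>c\<close>,
    \<open>k\<close> and then to \<open>c\<close>, \<open>d\<close>.\<close>
  have "c * d = d * c"
    using assms(3) c(3) d(3) by metis
  moreover from this have "g * k = (c * d) * (c * d)"
    unfolding c(2)[symmetric] d(2)[symmetric] by (metis mult.assoc)
  ultimately show ?thesis
    using square_positive[of "c * d"] c(1) d(1) by (simp add: star_mult star_positive)
qed

text \<open>With square roots \<open>c\<close>, \<open>d\<close> of \<open>t - a\<close> and \<open>t + a\<close> one has \<open>a\<^sup>2 + (c d)\<^sup>2 = t\<^sup>2\<close>.\<close>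

lemma norm_le_of_positives:
  fixes a :: "'a::unital_cstar_algebra"
  assumes m: "of_real t - a \<in> positives" and p: "of_real t + a \<in> positives"
  shows "norm a \<le> t"
proof -
  \<comment> \<open>The two hypotheses add up to the constant 2 t. Its positivity gives
    \<open>t >= 0\<close>, which the final passage from squares to norms uses.\<close>
  have "(of_real t - a) + (of_real t + a) = of_real (t + t)"
    unfolding of_real_add by (simp only: add_diff_eq diff_add_eq add_diff_cancel_right' add.assoc[symmetric])
  then have "t + t \<ge> 0"
    using positives_add[OF m p] of_real_positive_iff[of "t + t"] by metis
  then have "t \<ge> 0" by simp
  have "star a = a"
    using star_positive[OF p] by (simp add: star_add)
  have com: "b * of_real t = of_real t * b" for b :: 'a
    by (simp add: of_real_def)
  obtain c where c: "c \<in> positives" "c * c = of_real t - a"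
      "\<And>b. b * (of_real t - a) = (of_real t - a) * b \<Longrightarrow> b * c = c * b"
    using positive_square_root[OF m] by blast
  obtain d where d: "d \<in> positives" "d * d = of_real t + a"
      "\<And>b. b * (of_real t + a) = (of_real t + a) * b \<Longrightarrow> b * d = d * b"
    using positive_square_root[OF p] by blast
  have ac: "a * c = c * a"
    by (rule c(3)) (simp add: left_diff_distrib right_diff_distrib com)
  have ad: "a * d = d * a"
    by (rule d(3)) (simp add: distrib_left distrib_right com)
  have cd: "c * d = d * c"
    by (rule d(3)) (simp add: distrib_left distrib_right com[of c] ac)
  have "(c * d) * (c * d) = (c * c) * (d * d)"
    using cd by (metis mult.assoc)
  also have "\<dots> = of_real (t\<^sup>2) - a * a"
    unfolding c(2) d(2)
    by (simp add: distrib_left left_diff_distrib com[of a] power2_eq_square)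
  finally have "a * a + (c * d) * (c * d) = of_real (t\<^sup>2)"
    by simp
  moreover have "star (c * d) = c * d"
    using c(1) d(1) cd by (simp add: star_mult star_positive)
  moreover have "a * (c * d) = (c * d) * a"
    using ac ad by (metis mult.assoc)
  ultimately have "(norm a)\<^sup>2 \<le> norm (of_real (t\<^sup>2) :: 'a)"
    using norm_le_sum_squares[OF \<open>star a = a\<close>] by metis
  then have "(norm a)\<^sup>2 \<le> t\<^sup>2"
    by (simp del: of_real_power)
  then show ?thesis
    using \<open>t \<ge> 0\<close> power2_le_imp_le by blast
qed

section \<open>Inverses and strictly positive lower bounds\<close>

lemma invertible_one_minus:
  fixes z :: "'a::{real_normed_algebra_1,banach}"
  assumes "norm z < 1"
  shows "\<exists>p. p * (1 - z) = 1 \<and> (1 - z) * p = 1"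
proof -
  let ?s = "\<lambda>n. \<Sum>k<n. z ^ k"
  obtain p where p: "?s \<longlonglongrightarrow> p"
    using complete_algebra_summable_geometric[OF assms] summable_LIMSEQ by blast
  have l: "?s n * (1 - z) = 1 - z ^ n" for n
    by (induction n) 
      (simp_all add: distrib_right right_diff_distrib[of "z ^ _"] power_commutes)
  have r: "(1 - z) * ?s n = 1 - z ^ n" for n
    by (induction n) (simp_all add: distrib_left left_diff_distrib[of _ _ "z ^ _"])
  have "(\<lambda>n. 1 - z ^ n) \<longlonglongrightarrow> 1 - 0"
    by (intro tendsto_intros LIMSEQ_power_zero assms)
  moreover have "(\<lambda>n. 1 - z ^ n) \<longlonglongrightarrow> p * (1 - z)"
    unfolding l[symmetric] by (intro tendsto_intros p)
  moreover have "(\<lambda>n. 1 - z ^ n) \<longlonglongrightarrow> (1 - z) * p"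
    unfolding r[symmetric] by (intro tendsto_intros p)
  ultimately show ?thesis
    using LIMSEQ_unique by (metis diff_zero)
qed

text \<open>The element is (s + t) - (s - k) with \<open>norm (of_real s - k) <= s < s + t\<close>,
  so the Neumann series inverts it.\<close>

lemma invertible_of_real_add_positive:
  fixes k :: "'a::unital_cstar_algebra"
  assumes "k \<in> positives" and "t > 0"
  shows "\<exists>p. p * (of_real t + k) = 1 \<and> (of_real t + k) * p = 1"
proof -
  obtain s where s: "norm (of_real s - k) \<le> s"
    using assms by (auto simp: positives_def)
  then have "s + t > 0"
    using assms(2) by (meson norm_ge_zero order_trans add_nonneg_pos)
  define z where "z = (1 / (s + t)) *\<^sub>R (of_real s - k)"
  have "norm z < 1"
    using s assms(2) \<open>s + t > 0\<close> by (simp add: z_def)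
  then obtain p where p: "p * (1 - z) = 1" "(1 - z) * p = 1"
    using invertible_one_minus by blast
  have "of_real t + k = of_real (s + t) - (of_real s - k)"
    by simp
  also have "of_real s - k = (s + t) *\<^sub>R z"
    using \<open>s + t > 0\<close> by (simp add: z_def)
  finally have "of_real t + k = (s + t) *\<^sub>R (1 - z)"
    by (simp add: of_real_def algebra_simps)
  with p \<open>s + t > 0\<close> show ?thesis
    by (intro exI[of _ "(1 / (s + t)) *\<^sub>R p"]) simp
qed

text \<open>The usual reason why \<open>a * b\<close> and \<open>b * a\<close> have the same nonzero
  spectrum: a formal geometric series suggests \<open>1 - b * p * a\<close>, divided by
  \<open>t\<close>, as the inverse.\<close>

lemma invertible_of_real_add_mult_commute:
  fixes a b :: "'a::real_algebra_1"
  assumes "p * (of_real t + a * b) = 1" and "(of_real t + a * b) * p = 1" and "t \<noteq> 0"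
  shows "\<exists>q. q * (of_real t + b * a) = 1 \<and> (of_real t + b * a) * q = 1"
proof -
  have "(of_real t + b * a) * (1 - b * p * a) = of_real t + b * a - b * ((of_real t + a * b) * p) * a"
    by (simp add: algebra_simps of_real_def)
  then have r: "(of_real t + b * a) * (1 - b * p * a) = of_real t"
    by (simp add: assms)
  have "(1 - b * p * a) * (of_real t + b * a) = of_real t + b * a - b * (p * (of_real t + a * b)) * a"
    by (simp add: algebra_simps of_real_def)
  then have l: "(1 - b * p * a) * (of_real t + b * a) = of_real t"
    by (simp add: assms)
  show ?thesis
    using l r assms(3) by (intro exI[of _ "(1 / t) *\<^sub>R (1 - b * p * a)"]) (simp add: of_real_def)
qed

text \<open>Multiplying the positive element \<open>of_real (norm p) - p\<close> by
  \<open>q\<close>, with which it commutes, gives \<open>norm p *\<^sub>R q - 1\<close>; so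
  \<open>1 / norm p\<close> serves as the lower bound.\<close>

lemma positive_invertible_bounded_below:
  fixes q :: "'a::unital_cstar_algebra"
  assumes q: "q \<in> positives" and l: "p * q = 1" and r: "q * p = 1"
  shows "\<exists>\<delta>>0. q - of_real \<delta> \<in> positives"
proof -
  have "star p * q = 1"
    using r q by (metis star_mult star_one star_positive)
  then have sp: "star p = p"
    by (metis r mult.assoc mult.left_neutral mult.right_neutral)
  have "norm p > 0"
    using l by auto
  have "of_real (norm p) - p \<in> positives"
    using positives_of_norm_le[OF sp] by simp
  moreover have "q * (of_real (norm p) - p) = (of_real (norm p) - p) * q"
    by (simp add: algebra_simps l r of_real_def)
  ultimately have "q * (of_real (norm p) - p) \<in> positives"
    using q positives_mult by blast
  moreover have "q * (of_real (norm p) - p) = norm p *\<^sub>R q - 1"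
    by (simp add: algebra_simps r of_real_def)
  ultimately have "(1 / norm p) *\<^sub>R (norm p *\<^sub>R q - 1) \<in> positives"
    using positives_scaleR by (metis norm_ge_zero zero_le_divide_1_iff)
  moreover have "(1 / norm p) *\<^sub>R (norm p *\<^sub>R q - 1) = q - of_real (1 / norm p)"
    using \<open>norm p > 0\<close> by (simp add: of_real_def algebra_simps)
  ultimately show ?thesis
    using \<open>norm p > 0\<close> by (metis zero_less_divide_1_iff)
qed

lemma cartesian_decomposition:
  fixes d :: "'a::unital_cstar_algebra"
  obtains u v where "star u = u" and "star v = v" and "d = u + \<i> *\<^sub>C v"
proof
  let ?u = "(1/2) *\<^sub>R (d + star d)" and ?v = "(- \<i> / 2) *\<^sub>C (d - star d)"
  show "star ?u = ?u"
    by (simp add: star_scaleR star_add star_star add.commute)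
  have "star ?v = (\<i> / 2) *\<^sub>C (star d - d)"
    by (simp add: star_scaleC star_diff star_star star_minus)
  also have "\<dots> = ?v"
    by (simp add: complex_scaling.scale_right_diff_distrib)
  finally show "star ?v = ?v" .
  have "\<i> *\<^sub>C ?v = complex_of_real (1/2) *\<^sub>C (d - star d)"
    by (simp add: scaleC_scaleC)
  also have "\<dots> = (1/2) *\<^sub>R (d - star d)"
    by (rule scaleC_of_real)
  finally show "d = ?u + \<i> *\<^sub>C ?v"
    by (simp add: scaleR_right_distrib[symmetric] scaleR_2[symmetric])
qed

text \<open>In Cartesian form the commutators cancel. Adding a positive
  \<open>- (star d * d)\<close> will isolate \<open>d * star d\<close>.\<close>

lemma star_mult_self_add_positive:
  fixes d :: "'a::unital_cstar_algebra"
  shows "star d * d + d * star d \<in> positives"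
proof -
  obtain u v where uv: "star u = u" "star v = v" "d = u + \<i> *\<^sub>C v"
    using cartesian_decomposition by blast
  have "star d * d + d * star d = 2 *\<^sub>R (u * u + v * v)"
    unfolding uv(3) star_cartesian[OF uv(1,2)] cartesian_product
    by (simp add: scaleR_2 complex_scaling.scale_right_diff_distrib)
  then show ?thesis
    using uv by (auto intro!: positives_scaleR positives_add square_positive)
qed

text \<open>The elements \<open>d\<^sup>* d\<close> and \<open>d d\<^sup>*\<close> have the same nonzero spectrum, so if the former is
  negative and the latter positive, then both vanish.\<close>

lemma star_mult_self_negative:
  fixes d :: "'a::unital_cstar_algebra"
  assumes g: "- (star d * d) \<in> positives"
  shows "d = 0"
proof (rule ccontr)
  assume "d \<noteq> 0"
  let ?g = "- (star d * d)"
  define N where "N = norm ?g"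
  have "N > 0"
    using \<open>d \<noteq> 0\<close> star_mult_eq_0[of d] by (simp add: N_def)
  have "d * star d \<in> positives"
    using positives_add[OF star_mult_self_add_positive[of d] g] by simp
  \<comment> \<open>Positivity of \<open>d * star d\<close> makes
    \<open>of_real N + d * star d\<close> invertible; exchanging the factors preserves this.\<close>
  then have "\<exists>p. p * (of_real N + star d * d) = 1 \<and> (of_real N + star d * d) * p = 1"
    using invertible_of_real_add_positive[of "d * star d" N] \<open>N > 0\<close>
      invertible_of_real_add_mult_commute[of _ N d "star d"] by auto
  moreover have "of_real N + star d * d \<in> positives"
    using positives_of_norm_le(1)[of ?g N] star_positive[OF g] by (simp add: N_def)
  ultimately obtain \<delta> where \<delta>: "\<delta> > 0" "of_real N + star d * d - of_real \<delta> \<in> positives"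
    using positive_invertible_bounded_below by metis
  \<comment> \<open>Capping at \<open>N\<close> keeps \<open>N - \<epsilon>\<close> nonnegative, so
    \<open>N - \<epsilon>\<close> bounds \<open>?g\<close> from both sides, contradicting
    \<open>norm ?g = N\<close>.\<close>
  define \<epsilon> where "\<epsilon> = min \<delta> N"
  have "(of_real N + star d * d - of_real \<delta>) + of_real (\<delta> - \<epsilon>) \<in> positives"
    by (intro positives_add \<delta>) (simp add: of_real_positive_iff \<epsilon>_def del: of_real_diff)
  then have "of_real (N - \<epsilon>) - ?g \<in> positives"
    by (simp add: algebra_simps)
  moreover have "of_real (N - \<epsilon>) + ?g \<in> positives"
    by (intro positives_add g) (simp add: of_real_positive_iff \<epsilon>_def del: of_real_diff)
  ultimately have "norm ?g \<le> N - \<epsilon>"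
    by (rule norm_le_of_positives)
  with \<delta>(1) \<open>N > 0\<close> show False
    by (simp add: N_def \<epsilon>_def min_def split: if_splits)
qed

text \<open>With \<open>c = |x|\<close> for \<open>x = b\<^sup>* b\<close>, the element \<open>n = c - x\<close> is twice the negative part of
  \<open>x\<close>, and \<open>(b n)\<^sup>* (b n) = n x n = - n c n\<close> is negative.\<close>

theorem star_mult_self_positive:
  fixes b :: "'a::unital_cstar_algebra"
  shows "star b * b \<in> positives"
proof -
  define x where "x = star b * b"
  have sx: "star x = x"
    by (simp add: x_def star_mult star_star)
  obtain c where c: "c \<in> positives" "c * c = x * x"
      "\<And>a. a * (x * x) = (x * x) * a \<Longrightarrow> a * c = c * a"
    using positive_square_root[OF square_positive[OF sx]] by blast
  have xc: "x * c = c * x"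
    by (rule c(3)) (simp add: mult.assoc)
  define n where "n = c - x"
  have sn: "star n = n"
    by (simp add: n_def star_diff sx star_positive[OF c(1)])
  have xn: "x * n = - (c * n)"
    by (simp add: n_def algebra_simps c(2) xc)
  have nc: "n * c = c * n"
    by (simp add: n_def algebra_simps xc)
  have bn: "star (b * n) * (b * n) = n * x * n"
    by (simp add: star_mult sn x_def mult.assoc)
  have "(n * n) * c \<in> positives"
    by (rule positives_mult[OF square_positive[OF sn] c(1)]) (metis nc mult.assoc)
  then have "- (star (b * n) * (b * n)) \<in> positives"
    unfolding bn by (simp add: mult.assoc xn nc)
  then have "b * n = 0"
    by (rule star_mult_self_negative)
  then have "x * n = 0"
    by (simp add: x_def mult.assoc)
  \<comment> \<open>As \<open>x * n = - (c * n)\<close>, both products vanish, and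
    \<open>n * n = c * n - x * n\<close>. Then \<open>n = 0\<close> means that
    \<open>x = c\<close>.\<close>
  then have "n * n = 0"
    using xn by (simp add: n_def left_diff_distrib)
  then have "n = 0"
    using norm_self_adjoint_square[OF sn] by simp
  with c(1) show ?thesis
    by (simp add: n_def x_def)
qed

section \<open>States and the norm of self-adjoint elements\<close>

definition sublinear :: "('a::real_vector \<Rightarrow> real) \<Rightarrow> bool"
  where "sublinear p \<longleftrightarrow>
    (\<forall>x y. p (x + y) \<le> p x + p y) \<and> (\<forall>r\<ge>0. \<forall>x. p (r *\<^sub>R x) = r * p x)"

lemma sublinear_add: "sublinear p \<Longrightarrow> p (x + y) \<le> p x + p y"
  and sublinear_scaleR: "sublinear p \<Longrightarrow> r \<ge> 0 \<Longrightarrow> p (r *\<^sub>R x) = r * p x"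
  by (simp_all add: sublinear_def)

lemma sublinear_zero: "sublinear p \<Longrightarrow> p 0 = 0"
  using sublinear_scaleR[of p 0 0] by simp

lemma sublinear_minus_ge: "sublinear p \<Longrightarrow> - p (- x) \<le> p x"
  using sublinear_add[of p x "- x"] by (simp add: sublinear_zero)

text \<open>The assumed inequality for \<open>1 / r\<close> at \<open>r *\<^sub>R x\<close> is the
  reverse one.\<close>

lemma sublinearI:
  assumes "\<And>x y. p (x + y) \<le> p x + p y" and "p 0 = 0"
    and le: "\<And>r x. r > 0 \<Longrightarrow> p (r *\<^sub>R x) \<le> r * p x"
  shows "sublinear p"
proof -
  have "p (r *\<^sub>R x) = r * p x" if "r \<ge> 0" for r x
  proof (cases "r = 0")
    case False
    with that have "r > 0" by simp
    then have "r * p x \<le> p (r *\<^sub>R x)"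
      using le[of "1 / r" "r *\<^sub>R x"] by (simp add: field_simps)
    with le[OF \<open>r > 0\<close>] show ?thesis by (simp add: antisym)
  qed (simp add: assms)
  with assms show ?thesis by (simp add: sublinear_def)
qed

text \<open>The minorant is an infimum over \<open>t >= 0\<close>: \<open>t = 0\<close> gives
  \<open>q <= p\<close>, \<open>t = 1\<close> at \<open>- y\<close> gives \<open>- p y\<close>, and
  subadditivity keeps the infimum above \<open>- p (- x)\<close>.\<close>

lemma sublinear_directional_minorant:
  fixes p :: "'a::real_vector \<Rightarrow> real" and y :: 'a
  assumes p: "sublinear p"
  obtains q where "sublinear q" and "\<And>x. q x \<le> p x" and "q (- y) \<le> - p y"
proof -
  define q where "q x = (INF t\<in>{0..}. p (x + t *\<^sub>R y) - t * p y)" for x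
  have lower: "- p (- x) \<le> p (x + t *\<^sub>R y) - t * p y" if "t \<ge> 0" for x t
    using sublinear_add[OF p, of "x + t *\<^sub>R y" "- x"] sublinear_scaleR[OF p that, of y] by simp
  have le: "q x \<le> p (x + t *\<^sub>R y) - t * p y" if "t \<ge> 0" for x t
    unfolding q_def using lower that by (intro cINF_lower bdd_belowI2[of _ "- p (- x)"]) auto
  have ge: "c \<le> q x" if "\<And>t. t \<ge> 0 \<Longrightarrow> c \<le> p (x + t *\<^sub>R y) - t * p y" for c x
    unfolding q_def using that by (intro cINF_greatest) auto
  have "sublinear q"
  proof (rule sublinearI)
    fix x z
    have "q (x + z) - (p (z + s *\<^sub>R y) - s * p y) \<le> p (x + t *\<^sub>R y) - t * p y"
      if "s \<ge> 0" "t \<ge> 0" for s t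
    proof -
      have "x + z + (s + t) *\<^sub>R y = (x + t *\<^sub>R y) + (z + s *\<^sub>R y)"
        by (simp add: algebra_simps)
      then show ?thesis
        using le[of "s + t" "x + z"] sublinear_add[OF p, of "x + t *\<^sub>R y" "z + s *\<^sub>R y"] that
        by (simp add: algebra_simps)
    qed
    then have "q (x + z) - (p (z + s *\<^sub>R y) - s * p y) \<le> q x" if "s \<ge> 0" for s
      using that by (intro ge) auto
    then have "q (x + z) - q x \<le> p (z + s *\<^sub>R y) - s * p y" if "s \<ge> 0" for s
      using that by (simp add: algebra_simps)
    then have "q (x + z) - q x \<le> q z"
      by (intro ge)
    then show "q (x + z) \<le> q x + q z" by simp
  next
    show "q 0 = 0"
    proof (rule antisym)
      show "q 0 \<le> 0" using le[of 0 0] by (simp add: sublinear_zero[OF p])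
      show "0 \<le> q 0" by (rule ge) (simp add: sublinear_scaleR[OF p])
    qed
  next
    fix r :: real and x
    assume "r > 0"
    have "q (r *\<^sub>R x) / r \<le> p (x + t *\<^sub>R y) - t * p y" if "t \<ge> 0" for t
    proof -
      have "r *\<^sub>R x + (r * t) *\<^sub>R y = r *\<^sub>R (x + t *\<^sub>R y)"
        by (simp add: scaleR_add_right)
      then have "q (r *\<^sub>R x) \<le> r * (p (x + t *\<^sub>R y) - t * p y)"
        using le[of "r * t" "r *\<^sub>R x"] \<open>r > 0\<close> that
        by (simp add: sublinear_scaleR[OF p] right_diff_distrib)
      with \<open>r > 0\<close> show ?thesis by (simp add: field_simps)
    qed
    then have "q (r *\<^sub>R x) / r \<le> q x"
      by (rule ge)
    with \<open>r > 0\<close> show "q (r *\<^sub>R x) \<le> r * q x"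
      by (simp add: field_simps)
  qed
  moreover have "q x \<le> p x" for x
    using le[of 0 x] by simp
  moreover have "q (- y) \<le> - p y"
    using le[of 1 "- y"] by (simp add: sublinear_zero[OF p])
  ultimately show thesis
    using that by blast
qed

text \<open>Zorn's lemma for the reversed order: the pointwise infimum of a nonempty chain is again
  sublinear, and \<open>- p (- x)\<close> bounds it from below.\<close>

lemma sublinear_minimal_minorant:
  fixes p :: "'a::real_vector \<Rightarrow> real"
  assumes p: "sublinear p"
  obtains m where "sublinear m" and "\<And>x. m x \<le> p x"
    and "\<And>q. sublinear q \<Longrightarrow> (\<And>x. q x \<le> m x) \<Longrightarrow> q = m"
proof -
  define A where "A = {q. sublinear q \<and> q \<le> p}"
  have "\<exists>m\<in>A. \<forall>q\<in>A. q \<le> m \<longrightarrow> q = m"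
  proof (rule predicate_Zorn[where P = "\<lambda>q r. r \<le> q"])
    show "partial_order_on A (relation_of (\<lambda>q r. r \<le> q) A)"
      by (rule partial_order_on_relation_ofI) auto
  next
    fix C
    assume "C \<in> Chains (relation_of (\<lambda>q r. r \<le> q) A)"
    then have C: "C \<subseteq> A" and chain: "\<And>q r. q \<in> C \<Longrightarrow> r \<in> C \<Longrightarrow> q \<le> r \<or> r \<le> q"
      by (auto simp: Chains_def relation_of_def)
    show "\<exists>u\<in>A. \<forall>q\<in>C. u \<le> q"
    proof (cases "C = {}")
      case True
      then show ?thesis using p by (auto simp: A_def)
    next
      case False
      define u where "u x = (INF q\<in>C. q x)" for x
      have sub: "sublinear q" "q x \<le> p x" if "q \<in> C" for q x
        using that C by (auto simp: A_def le_fun_def)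
      have "- p (- x) \<le> q x" if "q \<in> C" for q x
        using sublinear_minus_ge[of q x] sub[OF that] by (smt (verit))
      then have le: "u x \<le> q x" if "q \<in> C" for q x
        unfolding u_def using that by (intro cINF_lower bdd_belowI2[of _ "- p (- x)"]) auto
      have ge: "c \<le> u x" if "\<And>q. q \<in> C \<Longrightarrow> c \<le> q x" for c x
        unfolding u_def using that False by (intro cINF_greatest) auto
      have "sublinear u"
      proof (rule sublinearI)
        fix x z
        have "u (x + z) - r z \<le> q x" if qr: "q \<in> C" "r \<in> C" for q r
        proof -
          \<comment> \<open>The chain supplies one \<open>s\<close> below both \<open>q\<close> and
            \<open>r\<close>, so its subadditivity transfers to the infimum.\<close>
          obtain s where "s \<in> C" "s \<le> q" "s \<le> r"
            using chain[OF qr] qr by blast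
          then have "u (x + z) \<le> s x + s z" "s x \<le> q x" "s z \<le> r z"
            using le[of s "x + z"] sublinear_add[OF sub(1), of s x z] by (auto simp: le_fun_def)
          then show ?thesis by simp
        qed
        then have "u (x + z) - r z \<le> u x" if "r \<in> C" for r
          using that by (intro ge) auto
        then have "u (x + z) - u x \<le> r z" if "r \<in> C" for r
          using that by (simp add: algebra_simps)
        then have "u (x + z) - u x \<le> u z"
          by (intro ge)
        then show "u (x + z) \<le> u x + u z" by simp
      next
        obtain q where q: "q \<in> C" using False by blast
        have "u 0 \<le> 0"
          using le[OF q, of 0] sublinear_zero[OF sub(1)[OF q]] by simp
        moreover have "0 \<le> u 0"
          by (intro ge) (simp add: sublinear_zero[OF sub(1)])
        ultimately show "u 0 = 0" by simp
      next
        fix r :: real and x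
        assume "r > 0"
        have "u (r *\<^sub>R x) / r \<le> q x" if "q \<in> C" for q
          using le[OF that, of "r *\<^sub>R x"] sublinear_scaleR[OF sub(1)[OF that], of r x] \<open>r > 0\<close>
          by (simp add: field_simps)
        then have "u (r *\<^sub>R x) / r \<le> u x"
          by (rule ge)
        with \<open>r > 0\<close> show "u (r *\<^sub>R x) \<le> r * u x"
          by (simp add: field_simps)
      qed
      moreover have "u \<le> p"
      proof (rule le_funI)
        fix x
        obtain q where "q \<in> C" using False by blast
        then show "u x \<le> p x" using le[of q x] sub(2)[of q x] by simp
      qed
      ultimately show ?thesis
        using le by (auto simp: A_def le_fun_def)
    qed
  qed
  then obtain m where m: "m \<in> A" "\<And>q. q \<in> A \<Longrightarrow> q \<le> m \<Longrightarrow> q = m"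
    by blast
  show thesis
  proof (rule that)
    show "sublinear m" "\<And>x. m x \<le> p x"
      using m(1) by (auto simp: A_def le_fun_def)
    show "q = m" if "sublinear q" "\<And>x. q x \<le> m x" for q
    proof -
      have "q \<le> m" using that by (simp add: le_fun_def)
      moreover have "q \<in> A" using m(1) that \<open>q \<le> m\<close> by (auto simp: A_def)
      ultimately show ?thesis using m(2) by blast
    qed
  qed
qed

text \<open>A minimal sublinear functional is odd, by minimality against its directional minorants,
  and an odd sublinear functional is linear.\<close>

theorem Hahn_Banach_sublinear:
  fixes p :: "'a::real_vector \<Rightarrow> real" and a :: 'a
  assumes "sublinear p"
  obtains f where "linear f" and "\<And>x. f x \<le> p x" and "f a = p a"
proof -
  \<comment> \<open>Starting below the directional minorant at \<open>a\<close> forces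
    \<open>m (- a) <= - p a\<close>; with oddness, \<open>p a\<close> is attained.\<close>
  obtain q where q: "sublinear q" "\<And>x. q x \<le> p x" "q (- a) \<le> - p a"
    using sublinear_directional_minorant[OF assms] by blast
  obtain m where m: "sublinear m" "\<And>x. m x \<le> q x"
    "\<And>r. sublinear r \<Longrightarrow> (\<And>x. r x \<le> m x) \<Longrightarrow> r = m"
    using sublinear_minimal_minorant[OF q(1)] by blast
  have odd: "m (- y) = - m y" for y
  proof -
    obtain r where r: "sublinear r" "\<And>x. r x \<le> m x" "r (- y) \<le> - m y"
      using sublinear_directional_minorant[OF m(1)] by blast
    then have "r = m" using m(3) by blast
    with r(3) sublinear_minus_ge[OF m(1), of y] show ?thesis by simp
  qed
  have "linear m"
  proof (rule linearI)
    show "m (x + y) = m x + m y" for x y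
      using sublinear_add[OF m(1), of x y] sublinear_add[OF m(1), of "x + y" "- y"]
      by (simp add: odd)
    show "m (r *\<^sub>R x) = r *\<^sub>R m x" for r x
    proof (cases "r \<ge> 0")
      case False
      then show ?thesis
        using sublinear_scaleR[OF m(1), of "- r" x] odd[of "r *\<^sub>R x"] by simp
    qed (simp add: sublinear_scaleR[OF m(1)])
  qed
  moreover have "m x \<le> p x" for x
    using m(2) q(2) order_trans by blast
  moreover have "p a \<le> m a"
    using m(2)[of "- a"] q(3) odd[of a] by simp
  ultimately show thesis
    using that antisym by metis
qed

section \<open>The top of the spectrum and states attaining it\<close>

lemma of_real_minus_positive_lower:
  assumes "of_real t - h \<in> positives"
  shows "- norm h \<le> t"
proof -
  have "star h = h"
    using star_positive[OF assms] by (simp add: star_diff)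
  then have "(of_real t - h) + (of_real (norm h) + h) \<in> positives"
    by (intro positives_add assms positives_of_norm_le(2)) auto
  also have "(of_real t - h) + (of_real (norm h) + h) = of_real (t + norm h)"
    by simp
  finally show ?thesis
    unfolding of_real_positive_iff by simp
qed

text \<open>For self-adjoint \<open>a\<close> this is the maximum of the spectrum of \<open>a\<close>.\<close>

definition top_value :: "'a::unital_cstar_algebra \<Rightarrow> real"
  where "top_value a = Inf {t. of_real t - (1/2) *\<^sub>R (a + star a) \<in> positives}"

lemma top_value_le:
  assumes "of_real t - (1/2) *\<^sub>R (a + star a) \<in> positives"
  shows "top_value a \<le> t"
  unfolding top_value_def using assms of_real_minus_positive_lower
  by (intro cInf_lower) (auto simp: bdd_below_def)

lemma top_value_greatest:
  assumes "\<And>t. of_real t - (1/2) *\<^sub>R (a + star a) \<in> positives \<Longrightarrow> c \<le> t"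
  shows "c \<le> top_value a"
proof -
  have "star ((1/2) *\<^sub>R (a + star a)) = (1/2) *\<^sub>R (a + star a)"
    by (simp add: star_scaleR star_add star_star add.commute)
  then show ?thesis
    unfolding top_value_def using assms positives_of_norm_le(1) by (intro cInf_greatest) blast+
qed

text \<open>Inherited from \<open>positives\<close> being a convex cone: admissible bounds add and
  scale.\<close>

lemma sublinear_top_value: "sublinear top_value"
proof (rule sublinearI)
  fix x y :: 'a
  let ?h = "\<lambda>x :: 'a. (1/2) *\<^sub>R (x + star x)"
  have "top_value (x + y) - s \<le> t"
    if "of_real s - ?h y \<in> positives" "of_real t - ?h x \<in> positives" for s t
  proof -
    have "of_real (s + t) - ?h (x + y) = (of_real s - ?h y) + (of_real t - ?h x)"
      by (simp add: star_add algebra_simps)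
    then show ?thesis
      using top_value_le[of "s + t" "x + y"] positives_add[OF that] by (metis diff_le_eq add.commute)
  qed
  then have "top_value (x + y) - s \<le> top_value x" if "of_real s - ?h y \<in> positives" for s
    using that by (intro top_value_greatest)
  then have "top_value (x + y) - top_value x \<le> s" if "of_real s - ?h y \<in> positives" for s
    using that by (simp add: algebra_simps)
  then have "top_value (x + y) - top_value x \<le> top_value y"
    by (intro top_value_greatest)
  then show "top_value (x + y) \<le> top_value x + top_value y" by simp
next
  show "top_value (0 :: 'a) = 0"
  proof (rule antisym)
    show "top_value (0 :: 'a) \<le> 0" by (rule top_value_le) simp
    show "0 \<le> top_value (0 :: 'a)" by (rule top_value_greatest) (simp add: of_real_positive_iff)
  qed
next
  fix r :: real and x :: 'a
  assume "r > 0"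
  let ?h = "\<lambda>x :: 'a. (1/2) *\<^sub>R (x + star x)"
  have "top_value (r *\<^sub>R x) / r \<le> t" if "of_real t - ?h x \<in> positives" for t
  proof -
    have "of_real (r * t) - ?h (r *\<^sub>R x) = r *\<^sub>R (of_real t - ?h x)"
      by (simp add: star_scaleR algebra_simps of_real_def)
    then have "top_value (r *\<^sub>R x) \<le> r * t"
      using top_value_le[of "r * t" "r *\<^sub>R x"] positives_scaleR[OF that, of r] \<open>r > 0\<close> by simp
    with \<open>r > 0\<close> show ?thesis by (simp add: field_simps)
  qed
  then have "top_value (r *\<^sub>R x) / r \<le> top_value x"
    by (rule top_value_greatest)
  with \<open>r > 0\<close> show "top_value (r *\<^sub>R x) \<le> r * top_value x"
    by (simp add: field_simps)
qed

lemma of_real_minus_positive_above_top_value: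
  assumes "star a = a" and "top_value a < t"
  shows "of_real t - a \<in> positives"
proof -
  have a: "(1/2) *\<^sub>R (a + star a) = a"
    using assms by (simp add: scaleR_2[symmetric])
  obtain s where s: "of_real s - a \<in> positives" "s < t"
    using top_value_greatest[of a t] assms(2) unfolding a by force
  have "(of_real s - a) + of_real (t - s) \<in> positives"
    using s by (intro positives_add) (simp_all only: of_real_positive_iff diff_ge_0_iff_ge less_imp_le)
  then show ?thesis by (simp add: algebra_simps)
qed

lemma norm_le_top_value:
  assumes "star a = a"
  shows "norm a \<le> max (top_value a) (top_value (- a))"
proof (rule dense_ge)
  fix t
  assume t: "max (top_value a) (top_value (- a)) < t"
  then have "of_real t - a \<in> positives" "of_real t - - a \<in> positives"
    using assms of_real_minus_positive_above_top_value[of a t]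
      of_real_minus_positive_above_top_value[of "- a" t] by (simp_all add: star_minus)
  then show "norm a \<le> t"
    using norm_le_of_positives[of t a] by simp
qed

lemma linear_scaleC_iff:
  "Vector_Spaces.linear scaleC (*) \<phi> \<longleftrightarrow>
    (\<forall>a b. \<phi> (a + b) = \<phi> a + \<phi> b) \<and> (\<forall>c a. \<phi> (c *\<^sub>C a) = c * \<phi> a)"
  using vector_space_scaleC vector_space_over_itself.vector_space_axioms
  by (auto simp: Vector_Spaces.linear_iff)

text \<open>A real functional dominated by \<open>top_value\<close> is positive and normalised; its
  complexification is the state.\<close>

lemma state_exists_top_value:
  fixes a :: "'a::unital_cstar_algebra"
  obtains \<phi> where "\<phi> \<in> state_space" and "Re (\<phi> a) = top_value a"
proof -
  obtain f where f: "linear f" "\<And>x. f x \<le> top_value x" "f a = top_value a"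
    using Hahn_Banach_sublinear[OF sublinear_top_value, of a] by blast
  interpret f: linear f by fact
  have le: "f x \<le> t" if "of_real t - (1/2) *\<^sub>R (x + star x) \<in> positives" for x t
    using f(2)[of x] top_value_le[OF that] by simp
  have le_sa: "f x \<le> t" if "star x = x" "of_real t - x \<in> positives" for x t
    using le[of t x] that by (simp add: scaleR_2[symmetric])
  have one: "f 1 = 1"
    using le_sa[of 1 1] le_sa[of "-1" "-1"] f.neg[of 1] by (simp add: star_minus)
  have pos: "f k \<ge> 0" if "k \<in> positives" for k
    using le_sa[of "- k" 0] that f.neg[of k] by (simp add: star_minus star_positive)
  \<comment> \<open>\<open>top_value\<close> sees only the self-adjoint part, so \<open>f\<close> is
    at most 0 at both \<open>x\<close> and \<open>- x\<close>.\<close>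
  have skew: "f x = 0" if "star x = - x" for x
    using le[of 0 x] le[of 0 "- x"] that f.neg[of x] by (simp add: star_minus)
  \<comment> \<open>The standard recovery of a complex functional from its real part, f(x) - i f(i
    x).\<close>
  define \<phi> where "\<phi> x = Complex (f x) (- f (\<i> *\<^sub>C x))" for x
  have decomp: "c *\<^sub>C x = Re c *\<^sub>R x + Im c *\<^sub>R (\<i> *\<^sub>C x)" for c and x :: 'a
    unfolding scaleC_of_real[symmetric] scaleC_scaleC scaleC_add_left[symmetric]
    by (subst complex_eq[of c]) (simp add: mult.commute)
  have "\<phi> (c *\<^sub>C x) = c * \<phi> x" for c x
  proof -
    have "f (\<i> *\<^sub>C c *\<^sub>C x) = f (Re c *\<^sub>R (\<i> *\<^sub>C x) - Im c *\<^sub>R x)"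
      using decomp[of "\<i> * c" x] by (simp add: scaleC_scaleC)
    then have "f (\<i> *\<^sub>C c *\<^sub>C x) = Re c * f (\<i> *\<^sub>C x) - Im c * f x"
      by (simp add: f.diff f.scaleR)
    moreover have "f (c *\<^sub>C x) = Re c * f x + Im c * f (\<i> *\<^sub>C x)"
      using decomp[of c x] by (simp add: f.add f.scaleR)
    ultimately show ?thesis
      by (simp add: \<phi>_def complex_eq_iff)
  qed
  moreover have "\<phi> (x + y) = \<phi> x + \<phi> y" for x y
    by (simp add: \<phi>_def scaleC_add_right f.add complex_eq_iff)
  \<comment> \<open>\<open>\<i> *\<^sub>C (star x * x)\<close> is skew, so the imaginary part
    vanishes; the real part is where positivity of \<open>star x * x\<close> enters.\<close>
  moreover have "\<phi> (star x * x) \<in> \<real>\<^sub>\<ge>\<^sub>0" for x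
    using pos[OF star_mult_self_positive[of x]] skew[of "\<i> *\<^sub>C (star x * x)"]
    by (simp add: \<phi>_def complex_nonneg_Reals_iff star_scaleC star_mult star_star)
  moreover have "\<phi> 1 = 1"
    using one skew[of "\<i> *\<^sub>C 1"] by (simp add: \<phi>_def star_scaleC complex_eq_iff)
  ultimately have "\<phi> \<in> state_space"
    by (simp add: state_space_def linear_scaleC_iff)
  moreover have "Re (\<phi> a) = top_value a"
    by (simp add: \<phi>_def f)
  ultimately show thesis
    using that by blast
qed

section \<open>Comparison of Lip-norms\<close>

lemma state_add: "\<phi> \<in> state_space \<Longrightarrow> \<phi> (a + b) = \<phi> a + \<phi> b"
  and state_scaleC: "\<phi> \<in> state_space \<Longrightarrow> \<phi> (c *\<^sub>C a) = c * \<phi> a"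
  and state_one: "\<phi> \<in> state_space \<Longrightarrow> \<phi> 1 = 1"
  by (simp_all add: state_space_def linear_scaleC_iff)

lemma state_scaleR: "\<phi> \<in> state_space \<Longrightarrow> \<phi> (r *\<^sub>R a) = of_real r * \<phi> a"
  by (metis scaleC_of_real state_scaleC)

lemma state_diff: "\<phi> \<in> state_space \<Longrightarrow> \<phi> (a - b) = \<phi> a - \<phi> b"
  using state_add[of \<phi> a "- b"] state_scaleR[of \<phi> "-1" b] by simp

lemma state_of_real: "\<phi> \<in> state_space \<Longrightarrow> \<phi> (of_real r) = of_real r"
  by (simp add: of_real_def[where 'a = 'a] state_scaleR state_one)

lemma state_positive:
  assumes "\<phi> \<in> state_space" and "k \<in> positives"
  shows "\<phi> k \<in> \<real>\<^sub>\<ge>\<^sub>0"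
proof -
  obtain c where "c \<in> positives" "c * c = k"
    using positive_square_root[OF assms(2)] by blast
  then have "k = star c * c"
    by (simp add: star_positive)
  with assms(1) show ?thesis
    by (simp add: state_space_def)
qed

text \<open>A state takes nonnegative real values at \<open>of_real (norm a) - a\<close> and
  \<open>of_real (norm a) + a\<close>, which settles both claims.\<close>

lemma state_self_adjoint:
  assumes "\<phi> \<in> state_space" and "star a = a"
  shows "Im (\<phi> a) = 0" and "\<bar>Re (\<phi> a)\<bar> \<le> norm a"
proof -
  have "\<phi> (of_real (norm a) - a) \<in> \<real>\<^sub>\<ge>\<^sub>0" "\<phi> (of_real (norm a) + a) \<in> \<real>\<^sub>\<ge>\<^sub>0"
    using assms by (auto intro!: state_positive[OF assms(1)] positives_of_norm_le)
  then show "Im (\<phi> a) = 0" "\<bar>Re (\<phi> a)\<bar> \<le> norm a"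
    using assms(1)
    by (auto simp: state_diff state_add state_of_real complex_nonneg_Reals_iff)
qed

lemma states_pointwise_bounded:
  fixes a :: "'a::unital_cstar_algebra"
  shows "\<exists>M. \<forall>\<phi>\<in>state_space. cmod (\<phi> a) \<le> M"
proof -
  obtain u v where uv: "star u = u" "star v = v" "a = u + \<i> *\<^sub>C v"
    using cartesian_decomposition by blast
  have "cmod (\<phi> a) \<le> norm u + norm v" if "\<phi> \<in> state_space" for \<phi>
  proof -
    have "cmod (\<phi> a) \<le> cmod (\<phi> u) + cmod (\<phi> v)"
      using norm_triangle_ineq[of "\<phi> u" "\<i> * \<phi> v"] that
      by (simp add: uv(3) state_add state_scaleC norm_mult)
    moreover have "cmod (\<phi> u) \<le> norm u" "cmod (\<phi> v) \<le> norm v"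
      using state_self_adjoint[OF that] uv(1,2) by (simp_all add: cmod_eq_Re)
    ultimately show ?thesis by simp
  qed
  then show ?thesis by blast
qed

lemma closed_state_space: "closed (state_space :: ('a::unital_cstar_algebra \<Rightarrow> complex) set)"
proof -
  have "state_space = (\<Inter>a b. {\<phi> :: 'a \<Rightarrow> complex. \<phi> (a + b) = \<phi> a + \<phi> b}) \<inter>
    (\<Inter>c a. {\<phi>. \<phi> (c *\<^sub>C a) = c * \<phi> a}) \<inter>
    (\<Inter>a. (\<lambda>\<phi>. \<phi> (star a * a)) -` \<real>\<^sub>\<ge>\<^sub>0) \<inter> {\<phi>. \<phi> 1 = 1}"
    by (auto simp: state_space_def linear_scaleC_iff)
  also have "closed \<dots>"
    by (intro closed_Int closed_INT ballI closed_Collect_eq closed_vimage closed_nonneg_Reals_complex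
        continuous_intros continuous_on_product_coordinates)
  finally show ?thesis .
qed

text \<open>The Banach-Alaoglu argument: a product of discs is compact by Tychonoff, and the state
  space is a closed part of it.\<close>

lemma compact_state_space: "compact (state_space :: ('a::unital_cstar_algebra \<Rightarrow> complex) set)"
proof -
  obtain M where M: "\<And>a :: 'a. \<forall>\<phi>\<in>state_space. cmod (\<phi> a) \<le> M a"
    using states_pointwise_bounded by metis
  let ?K = "Pi\<^sub>E UNIV (\<lambda>a :: 'a. cball (0 :: complex) (M a))"
  have "compactin (product_topology (\<lambda>_ :: 'a. euclidean :: complex topology) UNIV) ?K"
    unfolding compactin_PiE by simp
  then have "compact ?K"
    by (simp add: euclidean_product_topology)
  moreover have "state_space \<subseteq> ?K"
    using M by (auto simp: PiE_UNIV_domain)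
  ultimately show ?thesis
    using closed_state_space by (metis compact_Int_closed inf.absorb_iff2)
qed

text \<open>Some states attain \<open>top_value\<close> at \<open>b\<close> and at
  \<open>- b\<close>, and these two numbers bound the norm.\<close>

lemma norm_le_of_states:
  assumes "star b = b" and "\<And>\<phi>. \<phi> \<in> state_space \<Longrightarrow> cmod (\<phi> b) \<le> K"
  shows "norm b \<le> K"
proof -
  obtain \<phi> \<psi> where \<phi>: "\<phi> \<in> state_space" "Re (\<phi> b) = top_value b"
    and \<psi>: "\<psi> \<in> state_space" "Re (\<psi> (- b)) = top_value (- b)"
    by (meson state_exists_top_value)
  have "\<psi> (- b) = - \<psi> b"
    using state_scaleR[OF \<psi>(1), of "-1" b] by simp
  then have "top_value b \<le> K" "top_value (- b) \<le> K"
    using assms(2)[OF \<phi>(1)] assms(2)[OF \<psi>(1)] \<phi>(2) \<psi>(2)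
      complex_Re_le_cmod[of "\<phi> b"] complex_Re_le_cmod[of "- \<psi> b"] by simp_all
  then show ?thesis
    using norm_le_top_value[OF assms(1)] by simp
qed

text \<open>The metric induces the weak* topology, for which the state space is compact, so the
  diameter is finite.\<close>

lemma mk_metrizes_imp_bounded:
  assumes "mk_metrizes_weak_star L"
  obtains K where "\<And>\<phi> \<psi> a. \<phi> \<in> state_space \<Longrightarrow> \<psi> \<in> state_space \<Longrightarrow> a \<in> lip_ball L \<Longrightarrow>
    cmod (\<phi> a - \<psi> a) \<le> K"
proof -
  let ?d = "\<lambda>\<phi> \<psi>. enn2real (mk_dist L \<phi> \<psi>)"
  interpret Metric_space state_space ?d
    using assms by (simp add: mk_metrizes_weak_star_def)
  have "mtopology = top_of_set state_space"
    using assms by (simp add: mk_metrizes_weak_star_def weak_star_topology_def euclidean_product_topology)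
  then have "compactin mtopology state_space"
    using compact_state_space by (simp add: compactin_subtopology)
  then have "mbounded state_space"
    by (rule compactin_imp_mbounded)
  then obtain K where K: "?d \<phi> \<psi> \<le> K" if "\<phi> \<in> state_space" "\<psi> \<in> state_space" for \<phi> \<psi>
    by (auto simp: mbounded_alt)
  have "cmod (\<phi> a - \<psi> a) \<le> K"
    if "\<phi> \<in> state_space" "\<psi> \<in> state_space" "a \<in> lip_ball L" for \<phi> \<psi> a
  proof -
    \<comment> \<open>Finiteness rules out the default value 0 of \<open>enn2real\<close> at
      infinity, where monotonicity would fail.\<close>
    have fin: "mk_dist L \<phi> \<psi> < \<infinity>"
      using assms that by (simp add: mk_metrizes_weak_star_def)
    have "ennreal (cmod (\<phi> a - \<psi> a)) \<le> mk_dist L \<phi> \<psi>"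
      unfolding mk_dist_def using that(3) by (rule SUP_upper)
    then have "enn2real (ennreal (cmod (\<phi> a - \<psi> a))) \<le> ?d \<phi> \<psi>"
      using fin by (intro enn2real_mono) auto
    then show ?thesis
      using K[OF that(1,2)] by simp
  qed
  then show thesis
    using that by blast
qed

text \<open>After subtracting the value of one fixed state, the value of any other state is a
  difference of two states, bounded by the diameter; states are norming on self-adjoint
  elements.\<close>

lemma lip_ball_bounded_modulo_scalars:
  assumes "mk_metrizes_weak_star L"
  obtains K where "\<And>a. a \<in> lip_ball L \<Longrightarrow> \<exists>r. norm (a - r *\<^sub>R 1) \<le> K"
proof -
  obtain K where K: "\<And>\<phi> \<psi> a. \<phi> \<in> state_space \<Longrightarrow> \<psi> \<in> state_space \<Longrightarrow> a \<in> lip_ball L \<Longrightarrow>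
    cmod (\<phi> a - \<psi> a) \<le> K"
    using mk_metrizes_imp_bounded[OF assms] by blast
  obtain \<phi> where \<phi>: "(\<phi> :: 'a \<Rightarrow> complex) \<in> state_space"
    using state_exists_top_value by blast
  have "norm (a - Re (\<phi> a) *\<^sub>R 1) \<le> K" if a: "a \<in> lip_ball L" for a
  proof (rule norm_le_of_states)
    have sa: "star a = a"
      using a by (simp add: lip_ball_def lip_dom_def self_adjoints_iff)
    then show "star (a - Re (\<phi> a) *\<^sub>R 1) = a - Re (\<phi> a) *\<^sub>R 1"
      by (simp add: star_diff star_scaleR)
    fix \<psi> :: "'a \<Rightarrow> complex"
    assume \<psi>: "\<psi> \<in> state_space"
    have "\<psi> (a - Re (\<phi> a) *\<^sub>R 1) = \<psi> a - \<phi> a"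
      using state_self_adjoint(1)[OF \<phi> sa]
      by (simp add: state_diff[OF \<psi>] state_scaleR[OF \<psi>] state_one[OF \<psi>] complex_eq_iff)
    then show "cmod (\<psi> (a - Re (\<phi> a) *\<^sub>R 1)) \<le> K"
      using K[OF \<psi> \<phi> a] by simp
  qed
  then show thesis
    using that by blast
qed

text \<open>By Baire's theorem some dilate of \<open>V\<close> contains a relatively open subset of \<open>U\<close>, and
  convexity spreads this to all of \<open>U\<close>.\<close>

lemma closed_convex_absorbed:
  fixes U V :: "'a::banach set"
  assumes U: "closed U" "convex U" "bounded U"
    and V: "closed V" "convex V" "\<And>x. x \<in> V \<Longrightarrow> - x \<in> V"
    and cover: "\<And>x. x \<in> U \<Longrightarrow> \<exists>n. (1 / real (Suc n)) *\<^sub>R x \<in> V"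
  obtains c where "c > 0" and "\<And>x. x \<in> U \<Longrightarrow> c *\<^sub>R x \<in> V"
proof (cases "U = {}")
  case True
  then show thesis using that[of 1] by simp
next
  case False
  define F where "F n = {x \<in> U. (1 / real (Suc n)) *\<^sub>R x \<in> V}" for n
  have closedF: "closedin (top_of_set U) (F n)" for n
  proof -
    have "closed ((\<lambda>x. (1 / real (Suc n)) *\<^sub>R x) -` V)"
      by (intro closed_vimage V continuous_intros)
    moreover have "F n = U \<inter> (\<lambda>x. (1 / real (Suc n)) *\<^sub>R x) -` V"
      by (auto simp: F_def)
    ultimately show ?thesis
      by (simp add: closedin_closed_Int)
  qed
  \<comment> \<open>\<open>U\<close> is closed, hence completely metrizable, and the relatively
    closed pieces \<open>F n\<close> cover it; they cannot all have empty interior.\<close>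
  have "\<exists>n. top_of_set U interior_of F n \<noteq> {}"
  proof (rule ccontr)
    assume "\<not> ?thesis"
    moreover have "completely_metrizable_space (top_of_set U)"
      using U(1) by (simp add: completely_metrizable_space_closedin completely_metrizable_space_euclidean)
    ultimately have "top_of_set U interior_of \<Union>(range F) = {}"
      using closedF by (intro Baire_category_alt) auto
    moreover have "\<Union>(range F) = topspace (top_of_set U)"
      using cover by (auto simp: F_def)
    ultimately show False
      using False by (metis interior_of_topspace topspace_euclidean_subtopology)
  qed
  then obtain n a where "a \<in> top_of_set U interior_of F n"
    by blast
  then obtain T where T: "openin (top_of_set U) T" "a \<in> T" "T \<subseteq> F n"
    by (auto simp: interior_of_def)
  then obtain e where e: "e > 0" "\<And>x. x \<in> U \<Longrightarrow> dist x a < e \<Longrightarrow> x \<in> F n"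
    by (metis openin_euclidean_subtopology_iff subsetD)
  have a: "a \<in> U" "(1 / real (Suc n)) *\<^sub>R a \<in> V"
    using T by (auto simp: F_def)
  obtain M where M: "M > 0" "\<And>x. x \<in> U \<Longrightarrow> norm x \<le> M"
    using U(3) by (auto simp: bounded_pos)
  \<comment> \<open>Points of \<open>U\<close> are at most 2 M apart, so moving the fraction
    \<open>s\<close> of the way from \<open>a\<close> to any of them stays within \<open>e\<close>
    of \<open>a\<close>.\<close>
  define s where "s = min 1 (e / (4 * M))"
  have s: "0 < s" "s \<le> 1" "s * (2 * M) < e"
    using e(1) M(1) by (auto simp: s_def min_def field_simps)
  have "(s / (2 * real (Suc n))) *\<^sub>R y \<in> V" if y: "y \<in> U" for y
  proof -
    define x where "x = (1 - s) *\<^sub>R a + s *\<^sub>R y"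
    have "x \<in> U"
      unfolding x_def using U(2) a(1) y s by (intro convexD) auto
    have "norm (y - a) \<le> 2 * M"
      using M(2)[OF y] M(2)[OF a(1)] norm_triangle_ineq4[of y a] by simp
    then have "s * norm (y - a) \<le> s * (2 * M)"
      using s by (intro mult_left_mono) auto
    also note s(3)
    also have "s * norm (y - a) = norm (x - a)"
    proof -
      have "x - a = s *\<^sub>R (y - a)"
        by (simp add: x_def algebra_simps)
      then show ?thesis using s by simp
    qed
    finally have "dist x a < e"
      by (simp add: dist_norm)
    then have x: "(1 / real (Suc n)) *\<^sub>R x \<in> V"
      using e(2)[OF \<open>x \<in> U\<close>] by (simp add: F_def)
    \<comment> \<open>By symmetry and convexity \<open>V\<close> contains
      \<open>- (1 - s) *\<^sub>R ?v\<close>. Its midpoint with the scaled \<open>x\<close> cancels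
      \<open>a\<close> and leaves a multiple of \<open>y\<close>, whence the factor 2.\<close>
    let ?v = "(1 / real (Suc n)) *\<^sub>R a"
    have "(s / 2) *\<^sub>R ?v + (1 - s / 2) *\<^sub>R (- ?v) \<in> V"
      using V(2) a(2) V(3)[OF a(2)] s by (intro convexD) auto
    also have "(s / 2) *\<^sub>R ?v + (1 - s / 2) *\<^sub>R (- ?v) = (s / 2 - (1 - s / 2)) *\<^sub>R ?v"
      by (simp only: scaleR_left_diff_distrib scaleR_minus_right add_uminus_conv_diff)
    also have "s / 2 - (1 - s / 2) = - (1 - s)"
      by simp
    finally have "(1/2) *\<^sub>R ((1 / real (Suc n)) *\<^sub>R x) + (1/2) *\<^sub>R (- (1 - s) *\<^sub>R ?v) \<in> V"
      using V(2) x by (intro convexD) auto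
    also have "(1/2) *\<^sub>R ((1 / real (Suc n)) *\<^sub>R x) + (1/2) *\<^sub>R (- (1 - s) *\<^sub>R ?v)
        = (1 / (2 * real (Suc n))) *\<^sub>R (x - (1 - s) *\<^sub>R a)"
      by (simp add: scaleR_right_diff_distrib scaleR_left_diff_distrib diff_divide_distrib mult.commute
          del: of_nat_Suc)
    also have "\<dots> = (s / (2 * real (Suc n))) *\<^sub>R y"
      by (simp add: x_def)
    finally show ?thesis .
  qed
  then show thesis
    using s(1) by (intro that[of "s / (2 * real (Suc n))"]) auto
qed

section \<open>Lip-balls as closed symmetric convex sets\<close>

lemma lip_normD:
  assumes "lip_norm L"
  shows "subspace (lip_dom L)"
    and "\<And>a b. a \<in> lip_dom L \<Longrightarrow> b \<in> lip_dom L \<Longrightarrow> L (a + b) \<le> L a + L b"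
    and "\<And>r a. a \<in> lip_dom L \<Longrightarrow> L (r *\<^sub>R a) = ennreal \<bar>r\<bar> * L a"
    and "{a \<in> lip_dom L. L a = 0} = range (\<lambda>r. r *\<^sub>R 1)"
    and "mk_metrizes_weak_star L"
  using assms by (simp_all add: lip_norm_def)

lemma convex_lip_ball:
  assumes "lip_norm L"
  shows "convex (lip_ball L)"
proof (rule convexI)
  fix x y and u v :: real
  assume x: "x \<in> lip_ball L" and y: "y \<in> lip_ball L" and uv: "0 \<le> u" "0 \<le> v" "u + v = 1"
  have d: "u *\<^sub>R x \<in> lip_dom L" "v *\<^sub>R y \<in> lip_dom L"
    using x y lip_normD(1)[OF assms] by (auto simp: lip_ball_def subspace_scale)
  have "L (u *\<^sub>R x + v *\<^sub>R y) \<le> ennreal u * L x + ennreal v * L y"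
    using lip_normD(2)[OF assms d] lip_normD(3)[OF assms] x y uv by (simp add: lip_ball_def)
  also have "\<dots> \<le> ennreal u * 1 + ennreal v * 1"
    using x y by (intro add_mono mult_left_mono) (auto simp: lip_ball_def)
  also have "\<dots> = 1"
    using uv by (simp flip: ennreal_plus)
  finally show "u *\<^sub>R x + v *\<^sub>R y \<in> lip_ball L"
    using d lip_normD(1)[OF assms] by (simp add: lip_ball_def subspace_add)
qed

lemma lip_ball_minus:
  assumes "lip_norm L" and "a \<in> lip_ball L"
  shows "- a \<in> lip_ball L"
  using assms(2) lip_normD(1)[OF assms(1)] lip_normD(3)[OF assms(1), of a "-1"]
  by (auto simp: lip_ball_def subspace_neg)

lemma closed_lip_ball: "lip_lsc L \<Longrightarrow> closed (lip_ball L)"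
  unfolding lip_lsc_def using closed_self_adjoints closedin_closed_trans by blast

lemma lip_dom_absorbed_by_ball:
  assumes "lip_norm L" and "a \<in> lip_dom L"
  shows "\<exists>n. (1 / real (Suc n)) *\<^sub>R a \<in> lip_ball L"
proof -
  obtain l where l: "l \<ge> 0" "L a = ennreal l"
    using assms(2) by (cases "L a") (auto simp: lip_dom_def)
  obtain n :: nat where "l \<le> real n"
    using real_arch_simple by blast
  then have "(1 / real (Suc n)) * l \<le> 1"
    by (simp add: field_simps)
  then have "L ((1 / real (Suc n)) *\<^sub>R a) \<le> 1"
    using l lip_normD(3)[OF assms, of "1 / real (Suc n)"]
    by (simp add: ennreal_mult'[symmetric] del: of_nat_Suc)
  then show ?thesis
    using assms lip_normD(1)[OF assms(1)] by (auto simp: lip_ball_def subspace_scale)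
qed

lemma lip_norm_scalar:
  assumes "lip_norm L"
  shows "r *\<^sub>R 1 \<in> lip_dom L" and "L (r *\<^sub>R 1) = 0"
  using lip_normD(4)[OF assms] by blast+

lemma lip_norm_domination:
  assumes L\<^sub>1: "lip_norm L\<^sub>1" "lip_lsc L\<^sub>1" and L\<^sub>2: "lip_norm L\<^sub>2" "lip_lsc L\<^sub>2"
    and dom: "lip_dom L\<^sub>1 \<subseteq> lip_dom L\<^sub>2"
  obtains C where "C > 0" and "\<And>a. a \<in> self_adjoints \<Longrightarrow> L\<^sub>2 a \<le> ennreal C * L\<^sub>1 a"
proof -
  obtain K where K: "\<And>a. a \<in> lip_ball L\<^sub>1 \<Longrightarrow> \<exists>r. norm (a - r *\<^sub>R 1) \<le> K"
    using lip_ball_bounded_modulo_scalars[OF lip_normD(5)[OF L\<^sub>1(1)]] by blast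
  \<comment> \<open>By the choice of \<open>K\<close>, each element of the
    \<open>L\<^sub>1\<close>-ball has a translate by a scalar in \<open>?U\<close>.\<close>
  let ?U = "lip_ball L\<^sub>1 \<inter> cball 0 K"
  have "\<exists>n. (1 / real (Suc n)) *\<^sub>R x \<in> lip_ball L\<^sub>2" if "x \<in> ?U" for x
    using that dom by (intro lip_dom_absorbed_by_ball L\<^sub>2) (auto simp: lip_ball_def)
  then obtain c where c: "c > 0" "\<And>x. x \<in> ?U \<Longrightarrow> c *\<^sub>R x \<in> lip_ball L\<^sub>2"
    using closed_convex_absorbed[of ?U "lip_ball L\<^sub>2"] L\<^sub>1 L\<^sub>2
    by (metis closed_Int closed_cball closed_lip_ball convex_Int convex_cball convex_lip_ball
        bounded_Int bounded_cball lip_ball_minus)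
  have ball: "L\<^sub>2 a \<le> ennreal (1 / c)" if a: "a \<in> lip_ball L\<^sub>1" for a
  proof -
    obtain r where r: "norm (a - r *\<^sub>R 1) \<le> K"
      using K[OF a] by blast
    define b where "b = a - r *\<^sub>R 1"
    have "a \<in> lip_dom L\<^sub>1"
      using a by (simp add: lip_ball_def)
    then have b: "b \<in> lip_dom L\<^sub>1"
      unfolding b_def by (intro subspace_diff lip_normD(1) L\<^sub>1 lip_norm_scalar)
    have "L\<^sub>1 b \<le> L\<^sub>1 a + L\<^sub>1 ((- r) *\<^sub>R 1)"
      using lip_normD(2)[OF L\<^sub>1(1) \<open>a \<in> lip_dom L\<^sub>1\<close> lip_norm_scalar(1)[OF L\<^sub>1(1), of "- r"]]
      by (simp add: b_def)
    then have "b \<in> ?U"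
      using a b r lip_norm_scalar(2)[OF L\<^sub>1(1), of "- r"] by (auto simp: lip_ball_def b_def intro: order_trans)
    then have "c *\<^sub>R b \<in> lip_ball L\<^sub>2"
      by (rule c(2))
    then have cb: "c *\<^sub>R b \<in> lip_dom L\<^sub>2" "L\<^sub>2 (c *\<^sub>R b) \<le> 1"
      by (simp_all add: lip_ball_def)
    \<comment> \<open>\<open>L\<^sub>2\<close> vanishes on scalars, so the bound for
      \<open>b\<close> carries over to \<open>a\<close>.\<close>
    have "L\<^sub>2 a \<le> L\<^sub>2 b + L\<^sub>2 (r *\<^sub>R 1)"
      using lip_normD(2)[OF L\<^sub>2(1) _ lip_norm_scalar(1)[OF L\<^sub>2(1)], of b r] b dom
      by (auto simp: b_def)
    also have "\<dots> = L\<^sub>2 ((1 / c) *\<^sub>R (c *\<^sub>R b))"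
      using c(1) lip_norm_scalar(2)[OF L\<^sub>2(1)] by simp
    also have "\<dots> = ennreal (1 / c) * L\<^sub>2 (c *\<^sub>R b)"
      using lip_normD(3)[OF L\<^sub>2(1) cb(1), of "1 / c"] c(1) by simp
    also have "\<dots> \<le> ennreal (1 / c) * 1"
      using cb(2) by (intro mult_left_mono) auto
    finally show ?thesis by simp
  qed
  have "L\<^sub>2 a \<le> ennreal (1 / c) * L\<^sub>1 a" if "a \<in> self_adjoints" for a
  proof (cases "L\<^sub>1 a")
    case (real l)
    with that have a: "a \<in> lip_dom L\<^sub>1"
      by (simp add: lip_dom_def)
    show ?thesis
    proof (cases "l = 0")
      \<comment> \<open>Normalising by \<open>l\<close> is impossible here, but such an
        \<open>a\<close> is a scalar, on which \<open>L\<^sub>2\<close> vanishes too.\<close>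
      case True
      with real a have "a \<in> range (\<lambda>r. r *\<^sub>R 1)"
        using lip_normD(4)[OF L\<^sub>1(1)] by auto
      then have "L\<^sub>2 a = 0"
        using lip_norm_scalar(2)[OF L\<^sub>2(1)] by auto
      then show ?thesis by simp
    next
      case False
      with real have l: "l > 0" by simp
      have d: "(1 / l) *\<^sub>R a \<in> lip_dom L\<^sub>1"
        using a lip_normD(1)[OF L\<^sub>1(1)] by (rule subspace_scale[rotated])
      moreover have "L\<^sub>1 ((1 / l) *\<^sub>R a) = 1"
        using lip_normD(3)[OF L\<^sub>1(1) a, of "1 / l"] l real by (simp add: ennreal_mult'[symmetric])
      ultimately have "L\<^sub>2 ((1 / l) *\<^sub>R a) \<le> ennreal (1 / c)"
        by (intro ball) (simp add: lip_ball_def)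
      moreover have "L\<^sub>2 a = ennreal l * L\<^sub>2 ((1 / l) *\<^sub>R a)"
        using lip_normD(3)[OF L\<^sub>2(1), of "(1 / l) *\<^sub>R a" l] d dom l by auto
      ultimately have "L\<^sub>2 a \<le> ennreal l * ennreal (1 / c)"
        by (simp add: mult_left_mono)
      then show ?thesis
        using real by (simp add: mult.commute)
    qed
  next
    \<comment> \<open>Positivity of \<open>1 / c\<close> matters: in \<open>ennreal\<close>, 0 times
      infinity is 0.\<close>
    case top
    then show ?thesis
      using c(1) by (simp add: ennreal_mult_top)
  qed
  then show thesis
    using c(1) that[of "1 / c"] by simp
qed

lemma lip_dom_subset_of_le:
  assumes "\<And>a. a \<in> self_adjoints \<Longrightarrow> L\<^sub>2 a \<le> ennreal C * L\<^sub>1 a"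
  shows "lip_dom L\<^sub>1 \<subseteq> lip_dom L\<^sub>2"
  using assms by (force simp: lip_dom_def ennreal_mult_less_top intro: le_less_trans)

text \<open>Multiplications by \<open>C\<close> and \<open>inverse C\<close> are mutually inverse
  monotone maps, also at infinity. This makes the two halves of \<open>lip_equivalent\<close>
  symmetric.\<close>

lemma ennreal_inverse_mult_le_iff:
  assumes "C > 0"
  shows "ennreal (inverse C) * x \<le> y \<longleftrightarrow> x \<le> ennreal C * y"
proof
  have 1: "ennreal C * (ennreal (inverse C) * z) = z" "ennreal (inverse C) * (ennreal C * z) = z" for z
    using assms by (simp_all add: mult.assoc[symmetric] flip: ennreal_mult')
  show "x \<le> ennreal C * y" if "ennreal (inverse C) * x \<le> y"
    using mult_left_mono[OF that, of "ennreal C"] by (simp add: 1)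
  show "ennreal (inverse C) * x \<le> y" if "x \<le> ennreal C * y"
    using mult_left_mono[OF that, of "ennreal (inverse C)"] by (simp add: 1)
qed

theorem corollary2p6:
  fixes L\<^sub>1 L\<^sub>2 :: "'a::unital_cstar_algebra \<Rightarrow> ennreal"
  assumes "lip_norm L\<^sub>1" and "lip_lsc L\<^sub>1"
    and "lip_norm L\<^sub>2" and "lip_lsc L\<^sub>2"
  shows "lip_equivalent L\<^sub>1 L\<^sub>2 \<longleftrightarrow> lip_dom L\<^sub>1 = lip_dom L\<^sub>2"
proof
  assume "lip_equivalent L\<^sub>1 L\<^sub>2"
  then obtain C where "C > 0" "\<And>a. a \<in> self_adjoints \<Longrightarrow> L\<^sub>1 a \<le> ennreal C * L\<^sub>2 a"
    "\<And>a. a \<in> self_adjoints \<Longrightarrow> L\<^sub>2 a \<le> ennreal C * L\<^sub>1 a"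
    using ennreal_inverse_mult_le_iff by (auto simp: lip_equivalent_def)
  then show "lip_dom L\<^sub>1 = lip_dom L\<^sub>2"
    using lip_dom_subset_of_le by (metis subset_antisym)
next
  assume dom: "lip_dom L\<^sub>1 = lip_dom L\<^sub>2"
  obtain C where C: "C > 0" "\<And>a. a \<in> self_adjoints \<Longrightarrow> L\<^sub>2 a \<le> ennreal C * L\<^sub>1 a"
    using lip_norm_domination[OF assms] dom by auto
  obtain D where D: "D > 0" "\<And>a. a \<in> self_adjoints \<Longrightarrow> L\<^sub>1 a \<le> ennreal D * L\<^sub>2 a"
    using lip_norm_domination[OF assms(3,4,1,2)] dom by auto
  let ?M = "max C D"
  have "ennreal (inverse ?M) * L\<^sub>1 a \<le> L\<^sub>2 a \<and> L\<^sub>2 a \<le> ennreal ?M * L\<^sub>1 a"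
    if "a \<in> self_adjoints" for a
  proof
    have "ennreal D * L\<^sub>2 a \<le> ennreal ?M * L\<^sub>2 a"
      by (intro mult_right_mono ennreal_leI) auto
    with D(2)[OF that] show "ennreal (inverse ?M) * L\<^sub>1 a \<le> L\<^sub>2 a"
      using C(1) ennreal_inverse_mult_le_iff[of ?M] by (metis less_max_iff_disj order_trans)
    have "ennreal C * L\<^sub>1 a \<le> ennreal ?M * L\<^sub>1 a"
      by (intro mult_right_mono ennreal_leI) auto
    with C(2)[OF that] show "L\<^sub>2 a \<le> ennreal ?M * L\<^sub>1 a"
      by (rule order_trans)
  qed
  then show "lip_equivalent L\<^sub>1 L\<^sub>2"
    unfolding lip_equivalent_def using C(1) by (intro exI[of _ ?M]) auto
qed

end
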